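(* For every positive integer $k$ the limit \[ \gamma_k=\lim_{n\to\infty}\mathbf{E}\left[L(\Sigma(K_{n,n};k))/n\right] \] exists, and \[ \lim_{k\to\infty}\gamma_k\sqrt{k}=2. \]
   Context: Random words model: let $K_{n,n}$ be the complete bipartite graph with disjoint color classes $A$ and $B$, each totally ordered, with the elements of each class numbered $1,\dots,n$ in order. $\Sigma(K_{n,n};k)$ denotes the random subgraph of $K_{n,n}$ (and its distribution) obtained by assigning to each of the $2n$ nodes, uniformly and independently, one of $k$ characters, and keeping exactly those edges whose two endpoints are assigned equal characters. Two distinct edges $ab$ and $a'b'$ (with $a,a'\in A$, $b,b'\in B$) are noncrossing if $a<a'$ and $b<b'$, or $a'<a$ and $b'<b$. A matching is planar if every two distinct edges of it are noncrossing. For a bipartite graph $G$ with ordered color classes, $L(G)$ is the number of edges of a maximum size planar matching in $G$; $L(\Sigma(K_{n,n};k))$ is the random variable $L(G)$ with $G$ distributed as $\Sigma(K_{n,n};k)$. (Equivalently, it is the length of the longest common subsequence of two independent uniformly random words of length $n$ over a $k$-letter alphabet.) *)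

theory Defs
  imports "HOL-Probability.Probability" "HOL-Probability.Product_PMF"
begin

text \<open>
  A bipartite graph with linearly ordered color classes \<open>A\<close> and \<open>B\<close> is represented by its set of
  edges \<open>E \<subseteq> A \<times> B\<close>; the subgraphs considered below all have the full node set, so the edge set
  determines the graph.
\<close>

definition noncrossing :: "'a::linorder \<times> 'b::linorder \<Rightarrow> 'a \<times> 'b \<Rightarrow> bool" where
  "noncrossing e f \<longleftrightarrow>
     (fst e < fst f \<and> snd e < snd f) \<or> (fst f < fst e \<and> snd f < snd e)"

definition matching :: "('a \<times> 'b) set \<Rightarrow> bool" where
  "matching M \<longleftrightarrow> (\<forall>e\<in>M. \<forall>f\<in>M. e \<noteq> f \<longrightarrow> fst e \<noteq> fst f \<and> snd e \<noteq> snd f)"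

definition planar_matching :: "('a::linorder \<times> 'b::linorder) set \<Rightarrow> bool" where
  "planar_matching M \<longleftrightarrow> matching M \<and> (\<forall>e\<in>M. \<forall>f\<in>M. e \<noteq> f \<longrightarrow> noncrossing e f)"

text \<open>Meaningful for finite edge sets, where the set of cardinalities is finite and contains 0.\<close>

definition max_planar_matching :: "('a::linorder \<times> 'b::linorder) set \<Rightarrow> nat" where
  "max_planar_matching E = Max {card M | M. M \<subseteq> E \<and> planar_matching M}"

definition complete_bipartite :: "nat \<Rightarrow> (nat \<times> nat) set" where
  "complete_bipartite n = {1..n} \<times> {1..n}"

text \<open>
  The node set of the complete bipartite graph is the disjoint union \<open>{1..n} <+> {1..n}\<close>, with
  \<open>Inl\<close> marking the nodes of \<open>A\<close> and \<open>Inr\<close> those of \<open>B\<close>; the characters are \<open>1, \<dots>, k\<close>.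
  The value 0 is only the default of \<^const>\<open>Pi_pmf\<close> outside the node set.
  For \<open>k = 0\<close> the alphabet is empty and the distribution carries no meaning.
\<close>

definition random_assignment :: "nat \<Rightarrow> nat \<Rightarrow> (nat + nat \<Rightarrow> nat) pmf" where
  "random_assignment n k = Pi_pmf ({1..n} <+> {1..n}) 0 (\<lambda>_. pmf_of_set {1..k})"

definition random_words_graph :: "nat \<Rightarrow> nat \<Rightarrow> (nat \<times> nat) set pmf" where
  "random_words_graph n k =
     map_pmf (\<lambda>c. {(a, b) \<in> complete_bipartite n. c (Inl a) = c (Inr b)}) (random_assignment n k)"

end

theory Submission
  imports Defs "HOL-Real_Asymp.Real_Asymp"
begin

text \<open>
  Scan the second word letter by letter: each letter is a row of points, and a common subsequence is
  a strictly increasing chain of points. A chain uses at most one point of a row, so the gain of a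
  row is at most the sum of the gains of its points. Hence among all first words of length at
  most \<open>k\<close> the one with distinct letters maximises every increasing functional, and a first word with
  few repeated letters is almost as good.

  With distinct letters the scan is a discrete Hammersley process. Reserving \<open>d\<close> further letters as
  sinks makes the Bernoulli product measure of density \<open>1/(d+1)\<close> stationary, so the length with
  sources and sinks is a sum of two binomial variables of total mean \<open>r/(d+1) + s d/k\<close>, which is about
  \<open>2 n / sqrt k\<close> for \<open>r = s = n\<close> and \<open>d = sqrt k\<close>. It dominates the length without boundary.

  Upper bound: cut the first word into pieces of length \<open>k - d\<close>; the logarithm of the exponential
  moment of a piece is linear in the number of scanned letters, so a union bound over all ways to cut
  the second word is affordable. Lower bound: the exponential moment bound at a slightly different
  density rules out that a chain attains the stationary length while staying on the boundary for a
  fraction \<open>\<delta>\<close>, so the boundary contributes only \<open>O(\<delta> n / sqrt k)\<close>. Take \<open>n = k powr (5/8)\<close>, where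
  repeated letters are negligible but \<open>n / sqrt k\<close> beats \<open>log k\<close>, and use superadditivity.
\<close>

section \<open>Expectations over random lists\<close>

text \<open>The law of n independent letters as iterated finite sums, meant for finite support, so
  that no integrability conditions arise. The recursion exposes the first letter, the one that
  \<open>height\<close> scans first.\<close>

primrec expect_list :: "'a pmf \<Rightarrow> nat \<Rightarrow> ('a list \<Rightarrow> real) \<Rightarrow> real" where
  "expect_list p 0 f = f []"
| "expect_list p (Suc n) f = (\<Sum>c\<in>set_pmf p. pmf p c * expect_list p n (\<lambda>xs. f (c # xs)))"

lemma expect_list_add: "expect_list p n (\<lambda>xs. f xs + g xs) = expect_list p n f + expect_list p n g"
  by (induction n arbitrary: f g) (simp_all add: distrib_left sum.distrib)

lemma expect_list_cmult: "expect_list p n (\<lambda>xs. a * f xs) = a * expect_list p n f"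
  by (induction n arbitrary: f) (simp_all add: sum_distrib_left mult.left_commute)

lemma expect_list_diff: "expect_list p n (\<lambda>xs. f xs - g xs) = expect_list p n f - expect_list p n g"
  using expect_list_add[of p n f "\<lambda>xs. -1 * g xs"] expect_list_cmult[of p n "-1" g] by simp

lemma expect_list_sum:
  "expect_list p n (\<lambda>xs. \<Sum>i\<in>I. f i xs) = (\<Sum>i\<in>I. expect_list p n (f i))"
proof (induction n arbitrary: f)
  case (Suc n)
  show ?case by (simp add: Suc sum_distrib_left) (rule sum.swap)
qed simp

lemma expect_list_mono:
  assumes "\<And>xs. length xs = n \<Longrightarrow> set xs \<subseteq> set_pmf p \<Longrightarrow> f xs \<le> g xs"
  shows "expect_list p n f \<le> expect_list p n g"
  using assms by (induction n arbitrary: f g) (auto intro!: sum_mono mult_left_mono)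

lemma expect_list_cong:
  assumes "\<And>xs. length xs = n \<Longrightarrow> set xs \<subseteq> set_pmf p \<Longrightarrow> f xs = g xs"
  shows "expect_list p n f = expect_list p n g"
  using assms by (intro antisym expect_list_mono) auto

lemma expect_list_const:
  assumes "finite (set_pmf p)"
  shows "expect_list p n (\<lambda>xs. a) = a"
  using assms by (induction n) (simp_all flip: sum_distrib_right add: sum_pmf_eq_1)

lemma expect_list_append:
  "expect_list p (m + n) f = expect_list p m (\<lambda>xs. expect_list p n (\<lambda>ys. f (xs @ ys)))"
  by (induction m arbitrary: f) simp_all

text \<open>Exponential moment of a binomial variable: with q the mass of P, each letter contributes
  an independent factor 1 + (exp t - 1) q, at most exp ((exp t - 1) q). The sign of t is free;
  negative t serves for lower tails.\<close>

lemma expect_list_exp_filter: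
  assumes "finite (set_pmf p)"
  shows "expect_list p n (\<lambda>xs. exp (t * real (length (filter P xs))))
    \<le> exp (real n * ((exp t - 1) * (\<Sum>c\<in>{c\<in>set_pmf p. P c}. pmf p c)))"
proof (induction n)
  case (Suc n)
  let ?g = "expect_list p n (\<lambda>xs. exp (t * real (length (filter P xs))))"
  let ?q = "\<Sum>c\<in>{c\<in>set_pmf p. P c}. pmf p c"
  have "(\<Sum>c\<in>set_pmf p. pmf p c * (if P c then exp t else 1))
      = (\<Sum>c\<in>set_pmf p. pmf p c + (exp t - 1) * (if P c then pmf p c else 0))"
    by (intro sum.cong) (auto simp: algebra_simps)
  also have "\<dots> = 1 + (exp t - 1) * ?q"
    using assms by (simp add: sum.distrib sum_pmf_eq_1 flip: sum_distrib_left sum.inter_filter)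
  also have "\<dots> \<le> exp ((exp t - 1) * ?q)" by (rule exp_ge_add_one_self)
  finally have le: "(\<Sum>c\<in>set_pmf p. pmf p c * (if P c then exp t else 1)) \<le> exp ((exp t - 1) * ?q)" .
  have g0: "0 \<le> ?g"
    using expect_list_mono[of n p "\<lambda>_. 0" "\<lambda>xs. exp (t * real (length (filter P xs)))"]
      expect_list_const[OF assms, of n 0] by simp
  have "expect_list p (Suc n) (\<lambda>xs. exp (t * real (length (filter P xs))))
    = (\<Sum>c\<in>set_pmf p. pmf p c * (if P c then exp t else 1)) * ?g"
    by (auto simp: sum_distrib_right exp_add distrib_left expect_list_cmult intro!: sum.cong)
  also have "\<dots> \<le> exp ((exp t - 1) * ?q) * exp (real n * ((exp t - 1) * ?q))"
    using le Suc g0 by (intro mult_mono) auto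
  finally show ?case by (simp add: exp_add[symmetric] algebra_simps)
qed simp

lemma expect_list_length_filter:
  assumes "finite (set_pmf p)"
  shows "expect_list p n (\<lambda>xs. real (length (filter P xs))) = real n * (\<Sum>c\<in>{c\<in>set_pmf p. P c}. pmf p c)"
proof (induction n)
  case (Suc n)
  define q where "q = (\<Sum>c\<in>{c\<in>set_pmf p. P c}. pmf p c)"
  have q: "(\<Sum>c\<in>set_pmf p. if P c then pmf p c else 0) = q"
    using assms by (simp add: q_def sum.inter_filter)
  have "expect_list p (Suc n) (\<lambda>xs. real (length (filter P xs))) =
    (\<Sum>c\<in>set_pmf p. pmf p c * (real n * q) + (if P c then pmf p c else 0))"
    using Suc unfolding q_def
    by (auto simp: expect_list_add expect_list_const[OF assms] algebra_simps intro!: sum.cong)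
  also have "\<dots> = (\<Sum>c\<in>set_pmf p. pmf p c) * (real n * q) + q"
    by (simp only: sum.distrib q sum_distrib_right)
  also have "\<dots> = real (Suc n) * q"
    using assms by (simp add: sum_pmf_eq_1 algebra_simps)
  finally show ?case unfolding q_def .
qed simp

section \<open>Common subsequences and chains of points\<close>

text \<open>Last-passage recursion: if \<open>h x\<close> is the longest chain in the columns below
  x, a new row with points S may append one point i < x to a chain living below i. Inserting
  \<open>h x\<close> keeps the set nonempty for \<open>Max\<close>.\<close>

definition extend :: "nat set \<Rightarrow> (nat \<Rightarrow> nat) \<Rightarrow> nat \<Rightarrow> nat" where
  "extend S h x = Max (insert (h x) ((\<lambda>i. Suc (h i)) ` {i\<in>S. i < x}))"

definition occ :: "'a list \<Rightarrow> 'a \<Rightarrow> nat set" where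
  "occ as c = {i. i < length as \<and> as ! i = c}"

text \<open>The initial profile h is arbitrary because inductions over bs absorb the first row into
  it.\<close>

definition height :: "'a list \<Rightarrow> 'a list \<Rightarrow> (nat \<Rightarrow> nat) \<Rightarrow> nat \<Rightarrow> nat" where
  "height as bs = fold extend (map (occ as) bs)"

definition lcs :: "'a list \<Rightarrow> 'a list \<Rightarrow> nat" where
  "lcs as bs = height as bs (\<lambda>_. 0) (length as)"

lemma height_Nil [simp]: "height as [] h = h"
  and height_Cons [simp]: "height as (c # bs) h = height as bs (extend (occ as c) h)"
  and height_append: "height as (bs @ cs) h = height as cs (height as bs h)"
  by (simp_all add: height_def)

lemma height_snoc: "height as (bs @ [c]) h = extend (occ as c) (height as bs h)"
  by (simp add: height_append)

lemma extend_le_iff: "extend S h x \<le> m \<longleftrightarrow> h x \<le> m \<and> (\<forall>i\<in>S. i < x \<longrightarrow> Suc (h i) \<le> m)"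
proof -
  have "finite {i\<in>S. i < x}" by (rule finite_subset[of _ "{..<x}"]) auto
  then show ?thesis unfolding extend_def by (subst Max_le_iff) auto
qed

lemma extend_ge: "h x \<le> extend S h x"
  and extend_ge_Suc: "i \<in> S \<Longrightarrow> i < x \<Longrightarrow> Suc (h i) \<le> extend S h x"
  using extend_le_iff[of S h x "extend S h x"] by auto

lemma extend_cases:
  obtains "extend S h x = h x" | i where "i \<in> S" "i < x" "extend S h x = Suc (h i)"
proof -
  have "finite {i\<in>S. i < x}" by (rule finite_subset[of _ "{..<x}"]) auto
  then have "extend S h x \<in> insert (h x) ((\<lambda>i. Suc (h i)) ` {i\<in>S. i < x})"
    unfolding extend_def by (intro Max_in) auto
  then show ?thesis using that by auto
qed

lemma extend_empty [simp]: "extend {} h = h"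
  by (simp add: extend_def fun_eq_iff)

lemma extend_mono:
  assumes "\<And>y. y \<le> x \<Longrightarrow> h y \<le> g y"
  shows "extend S h x \<le> extend S g x"
  unfolding extend_le_iff[of S h]
proof safe
  show "h x \<le> extend S g x" using assms[of x] extend_ge[of g x S] by linarith
next
  fix i assume "i \<in> S" "i < x"
  then show "Suc (h i) \<le> extend S g x" using assms[of i] extend_ge_Suc[of i S x g] by linarith
qed

lemma extend_le_Suc:
  assumes "mono h" shows "extend S h x \<le> Suc (h x)"
  using assms by (auto simp: extend_le_iff mono_def)

lemma mono_extend: "mono h \<Longrightarrow> mono (extend S h)"
proof (rule monoI)
  fix x y :: nat assume "mono h" "x \<le> y"
  then have "h x \<le> h y" by (rule monoD)
  with \<open>x \<le> y\<close> show "extend S h x \<le> extend S h y"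
    using extend_ge[of h y S] extend_ge_Suc[of _ S y h] by (auto simp: extend_le_iff)
qed

lemma mono_height: "mono h \<Longrightarrow> mono (height as bs h)"
  by (induction bs arbitrary: h) (simp_all add: mono_extend)

text \<open>Together with \<open>extend_sup\<close> this makes \<open>extend S\<close>, and hence
  \<open>height as bs\<close>, linear over the max-plus semiring.\<close>

lemma extend_shift: "extend S (\<lambda>y. m + h y) x = m + extend S h x"
proof (rule antisym)
  show "extend S (\<lambda>y. m + h y) x \<le> m + extend S h x"
    using extend_ge[of h x S] extend_ge_Suc[of _ S x h] by (auto simp: extend_le_iff)
  show "m + extend S h x \<le> extend S (\<lambda>y. m + h y) x"
    using extend_ge[of "\<lambda>y. m + h y" x S] extend_ge_Suc[of _ S x "\<lambda>y. m + h y"]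
    by (cases rule: extend_cases[of S h x]) auto
qed

lemma extend_sup: "extend S (\<lambda>y. max (h y) (g y)) x = max (extend S h x) (extend S g x)"
proof (rule antisym)
  have "max (h x) (g x) \<le> max (extend S h x) (extend S g x)"
    by (rule max.mono) (rule extend_ge)+
  moreover have "Suc (max (h i) (g i)) \<le> max (extend S h x) (extend S g x)" if "i \<in> S" "i < x" for i
    unfolding max_Suc_Suc[symmetric] by (rule max.mono) (rule extend_ge_Suc[OF that])+
  ultimately show "extend S (\<lambda>y. max (h y) (g y)) x \<le> max (extend S h x) (extend S g x)"
    by (auto simp: extend_le_iff)
  show "max (extend S h x) (extend S g x) \<le> extend S (\<lambda>y. max (h y) (g y)) x"
    by (auto intro!: extend_mono)
qed

lemma extend_insert: "extend (insert i S) h x = max (extend {i} h x) (extend S h x)"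
proof (rule antisym)
  have "Suc (h j) \<le> max (extend {i} h x) (extend S h x)" if "j \<in> insert i S" "j < x" for j
    using that extend_ge_Suc[of j "{i}" x h] extend_ge_Suc[of j S x h] by (auto simp: le_max_iff_disj)
  moreover have "h x \<le> max (extend {i} h x) (extend S h x)"
    using extend_ge[of h x S] by (simp add: le_max_iff_disj)
  ultimately show "extend (insert i S) h x \<le> max (extend {i} h x) (extend S h x)"
    by (simp add: extend_le_iff[of "insert i S"])
  show "max (extend {i} h x) (extend S h x) \<le> extend (insert i S) h x"
    unfolding max.bounded_iff extend_le_iff[of "{i}"] extend_le_iff[of S]
    by (auto intro: extend_ge extend_ge_Suc)
qed

lemma height_le:
  "(\<And>y. y \<le> x \<Longrightarrow> h y \<le> g y) \<Longrightarrow> height as bs h x \<le> height as bs g x"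
proof (induction bs arbitrary: h g)
  case (Cons c bs)
  have "extend (occ as c) h y \<le> extend (occ as c) g y" if "y \<le> x" for y
    using that Cons.prems by (intro extend_mono) simp
  then show ?case using Cons.IH by simp
qed simp

lemma height_shift: "height as bs (\<lambda>y. m + h y) x = m + height as bs h x"
proof (induction bs arbitrary: h)
  case (Cons c bs)
  have "extend (occ as c) (\<lambda>y. m + h y) = (\<lambda>y. m + extend (occ as c) h y)"
    by (simp add: extend_shift fun_eq_iff)
  then show ?case using Cons by simp
qed simp

lemma height_sup: "height as bs (\<lambda>y. max (h y) (g y)) x = max (height as bs h x) (height as bs g x)"
proof (induction bs arbitrary: h g)
  case (Cons c bs)
  have "extend (occ as c) (\<lambda>y. max (h y) (g y)) = (\<lambda>y. max (extend (occ as c) h y) (extend (occ as c) g y))"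
    by (simp add: extend_sup fun_eq_iff)
  then show ?case using Cons by simp
qed simp

lemma height_extend_le_Suc:
  assumes "mono h" shows "height as bs (extend S h) x \<le> Suc (height as bs h x)"
proof -
  have "height as bs (extend S h) x \<le> height as bs (\<lambda>y. 1 + h y) x"
    using extend_le_Suc[OF assms] by (intro height_le) simp
  then show ?thesis by (simp only: height_shift)
qed

text \<open>Points of a single row are never comparable, so a chain uses at most one of them.\<close>

lemma height_extend_cases:
  assumes "finite S"
  shows "height as bs (extend S h) x = height as bs h x \<or>
    (\<exists>i\<in>S. height as bs (extend S h) x = height as bs (extend {i} h) x)"
  using assms
proof (induction S rule: finite_induct)
  case (insert i S)
  have "extend (insert i S) h = (\<lambda>y. max (extend {i} h y) (extend S h y))"
    by (rule ext) (rule extend_insert)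
  then have "height as bs (extend (insert i S) h) x =
      max (height as bs (extend {i} h) x) (height as bs (extend S h) x)"
    by (simp add: height_sup)
  then consider "height as bs (extend (insert i S) h) x = height as bs (extend {i} h) x"
    | "height as bs (extend (insert i S) h) x = height as bs (extend S h) x"
    unfolding max_def by presburger
  then show ?case
  proof cases
    case 2
    show ?thesis unfolding 2 using insert.IH by blast
  next
    case 1
    then show ?thesis by blast
  qed
qed simp

lemma finite_occ [simp]: "finite (occ as c)"
  by (simp add: occ_def)

lemma occ_upt [simp]: "occ [0..<r] c = (if c < r then {c} else {})"
  by (auto simp: occ_def)

lemma height_le_length: "mono h \<Longrightarrow> height as bs h x \<le> length bs + h x"
proof (induction bs arbitrary: h)
  case (Cons c bs)
  from Cons.IH[OF mono_extend[OF Cons.prems], of "occ as c"] extend_le_Suc[OF Cons.prems, of "occ as c" x]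
  show ?case by simp
qed simp

lemma lcs_le_length: "lcs as bs \<le> length bs"
  using height_le_length[of "\<lambda>_. 0" as bs "length as"] by (simp add: lcs_def mono_def)

text \<open>The points of as' reappear in as @ as' shifted by \<open>length as\<close>, so a lead of
  m between the two profiles survives every row.\<close>

lemma height_append_ge:
  assumes "\<And>x. x \<le> length as' \<Longrightarrow> m + g x \<le> h (length as + x)"
  shows "x \<le> length as' \<Longrightarrow> m + height as' bs g x \<le> height (as @ as') bs h (length as + x)"
  using assms
proof (induction bs arbitrary: g h)
  case (Cons c bs)
  have "m + extend (occ as' c) g y \<le> extend (occ (as @ as') c) h (length as + y)" if y: "y \<le> length as'" for y
  proof (cases rule: extend_cases[of "occ as' c" g y])
    case 1
    then show ?thesis
      using Cons.prems(2)[OF y] extend_ge[of h "length as + y" "occ (as @ as') c"] by linarith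
  next
    case (2 i)
    then have "length as + i \<in> occ (as @ as') c" by (auto simp: occ_def)
    with 2 have "Suc (h (length as + i)) \<le> extend (occ (as @ as') c) h (length as + y)"
      by (intro extend_ge_Suc) auto
    with 2 y Cons.prems(2)[of i] show ?thesis by simp
  qed
  then show ?case using Cons by simp
qed simp

text \<open>The value at x depends only on columns left of x, so letters appended on the right are
  invisible.\<close>

lemma height_append_left:
  assumes "\<And>x. x \<le> length as \<Longrightarrow> g x = h x"
  shows "x \<le> length as \<Longrightarrow> height (as @ as') bs g x = height as bs h x"
  using assms
proof (induction bs arbitrary: g h)
  case (Cons c bs)
  have "extend (occ (as @ as') c) g y = extend (occ as c) h y" if y: "y \<le> length as" for y
  proof -
    have "{i \<in> occ (as @ as') c. i < y} = {i \<in> occ as c. i < y}"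
      using y by (auto simp: occ_def nth_append)
    with y show ?thesis unfolding extend_def
      by (auto simp: Cons.prems(2) intro!: arg_cong[where f = Max] arg_cong2[where f = insert] image_cong)
  qed
  then show ?case using Cons by simp
qed simp

text \<open>After the rows of bs every column right of \<open>as\<close> has height at least
  \<open>lcs as bs\<close>; this is the lead with which the scan of bs' starts.\<close>

lemma lcs_append_ge: "lcs as bs + lcs as' bs' \<le> lcs (as @ as') (bs @ bs')"
proof -
  let ?h = "height (as @ as') bs (\<lambda>_. 0)"
  have eq: "?h (length as) = lcs as bs"
    unfolding lcs_def by (rule height_append_left) auto
  have "mono ?h" by (rule mono_height) (simp add: mono_def)
  then have "lcs as bs + (0::nat) \<le> ?h (length as + x)" for x
    unfolding eq[symmetric] by (simp add: mono_def)
  with height_append_ge[of as' "lcs as bs" "\<lambda>_. 0" ?h as "length as'" bs']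
  show ?thesis by (simp add: lcs_def[of as'] lcs_def[of "as @ as'"] height_append)
qed

text \<open>A chain passes from the columns of \<open>as\<close> to those of as' at one moment of
  the scan; j is that moment.\<close>

lemma lcs_append_le:
  "\<exists>j\<le>length bs. lcs (as @ as') bs \<le> lcs as (take j bs) + lcs as' (drop j bs)"
proof -
  \<comment> \<open>Claimed for all columns x of as', because the last point of a chain may continue
    a chain ending at any earlier column.\<close>
  have "\<exists>j\<le>length bs. height (as @ as') bs (\<lambda>_. 0) (length as + x) \<le>
      lcs as (take j bs) + height as' (drop j bs) (\<lambda>_. 0) x" if "x \<le> length as'" for x
    using that
  proof (induction bs arbitrary: x rule: rev_induct)
    case (snoc c bs)
    let ?h = "height (as @ as') bs (\<lambda>_. 0)"
    show ?case
    proof (cases rule: extend_cases[of "occ (as @ as') c" ?h "length as + x"])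
      case 1
      from snoc obtain j where j: "j \<le> length bs"
        "?h (length as + x) \<le> lcs as (take j bs) + height as' (drop j bs) (\<lambda>_. 0) x" by blast
      have "height as' (drop j bs) (\<lambda>_. 0) x \<le> height as' (drop j bs @ [c]) (\<lambda>_. 0) x"
        by (simp add: height_snoc extend_ge)
      with j 1 show ?thesis by (intro exI[of _ j]) (auto simp: height_snoc)
    next
      case (2 i)
      show ?thesis
      proof (cases "i < length as")
        case True
        then have "height (as @ as') bs (\<lambda>_. 0) i = height as bs (\<lambda>_. 0) i"
          by (intro height_append_left) auto
        moreover have "i \<in> occ as c" using 2 True by (auto simp: occ_def nth_append)
        ultimately have "extend (occ (as @ as') c) ?h (length as + x) \<le> lcs as (bs @ [c])"
          using 2 True extend_ge_Suc[of i "occ as c" "length as" "height as bs (\<lambda>_. 0)"]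
          by (simp add: lcs_def height_snoc)
        \<comment> \<open>The last point still lies in the columns of \<open>as\<close>, so the cut
          comes after all rows.\<close>
        then show ?thesis by (intro exI[of _ "Suc (length bs)"]) (simp add: height_snoc)
      next
        case False
        then obtain i' where i: "i = length as + i'" using le_Suc_ex not_le by blast
        with 2 have i': "i' < x" "i' \<in> occ as' c" by (auto simp: occ_def)
        with snoc obtain j where j: "j \<le> length bs"
          "?h (length as + i') \<le> lcs as (take j bs) + height as' (drop j bs) (\<lambda>_. 0) i'"
          by (meson le_trans less_imp_le)
        have "Suc (height as' (drop j bs) (\<lambda>_. 0) i') \<le> height as' (drop j bs @ [c]) (\<lambda>_. 0) x"
          using i' by (simp add: height_snoc extend_ge_Suc)
        with j 2 i show ?thesis by (intro exI[of _ j]) (auto simp: height_snoc)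
      qed
    qed
  qed (simp add: lcs_def)
  from this[of "length as'"] show ?thesis by (simp add: lcs_def)
qed

section \<open>Planar matchings as chains of points\<close>

lemma planar_matching_altdef:
  "planar_matching M \<longleftrightarrow> (\<forall>e\<in>M. \<forall>f\<in>M. e \<noteq> f \<longrightarrow> noncrossing e f)"
proof -
  have "fst e \<noteq> fst f \<and> snd e \<noteq> snd f" if "noncrossing e f" for e f :: "'a \<times> 'b"
    using that by (auto simp: noncrossing_def)
  then show ?thesis unfolding planar_matching_def matching_def by blast
qed

text \<open>Vertices are numbered from 1 as in \<open>complete_bipartite\<close>, list positions
  from 0, hence the shift.\<close>

definition word_edges :: "'a list \<Rightarrow> 'a list \<Rightarrow> (nat \<times> nat) set" where
  "word_edges as bs = {(i, j). i \<in> {1..length as} \<and> j \<in> {1..length bs} \<and> as ! (i - 1) = bs ! (j - 1)}"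

lemma finite_word_edges: "finite (word_edges as bs)"
  by (rule finite_subset[of _ "{1..length as} \<times> {1..length bs}"]) (auto simp: word_edges_def)

lemma Suc_Suc_in_word_edges:
  "(Suc i, Suc j) \<in> word_edges as bs \<longleftrightarrow> i < length as \<and> j < length bs \<and> as ! i = bs ! j"
  by (auto simp: word_edges_def)

lemma word_edgesE:
  assumes "e \<in> word_edges as bs"
  obtains i j where "e = (Suc i, Suc j)" "i < length as" "j < length bs" "as ! i = bs ! j"
proof -
  obtain i j where e: "e = (i, j)" by (cases e)
  with assms have "i \<noteq> 0" "j \<noteq> 0" by (auto simp: word_edges_def)
  then obtain i' j' where "i = Suc i'" "j = Suc j'" by (meson not0_implies_Suc)
  with assms e that show ?thesis by (simp add: Suc_Suc_in_word_edges)
qed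

lemma word_edges_snoc:
  "word_edges as (bs @ [c]) = word_edges as bs \<union> (\<lambda>i. (Suc i, Suc (length bs))) ` occ as c"
proof (intro set_eqI iffI)
  fix e assume "e \<in> word_edges as (bs @ [c])"
  then show "e \<in> word_edges as bs \<union> (\<lambda>i. (Suc i, Suc (length bs))) ` occ as c"
  proof (rule word_edgesE)
    fix i j assume "e = (Suc i, Suc j)" "i < length as" "j < length (bs @ [c])" "as ! i = (bs @ [c]) ! j"
    then show ?thesis
      by (cases "j = length bs") (simp_all add: Suc_Suc_in_word_edges occ_def nth_append)
  qed
next
  fix e assume "e \<in> word_edges as bs \<union> (\<lambda>i. (Suc i, Suc (length bs))) ` occ as c"
  then show "e \<in> word_edges as (bs @ [c])"
    by (elim UnE imageE word_edgesE) (simp_all add: Suc_Suc_in_word_edges occ_def nth_append)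
qed

text \<open>At most one edge of M uses the last letter, and all others lie strictly to its left and
  in earlier rows. With vertices numbered from 1, \<open>fst e \<le> x\<close> says that the list
  position is below x.\<close>

lemma card_planar_matching_le_height:
  assumes "M \<subseteq> word_edges as bs" "planar_matching M" "\<forall>e\<in>M. fst e \<le> x"
  shows "card M \<le> height as bs (\<lambda>_. 0) x"
  using assms
proof (induction bs arbitrary: M x rule: rev_induct)
  case Nil
  then have "M = {}" by (auto simp: word_edges_def)
  then show ?case by simp
next
  case (snoc c bs)
  show ?case
  proof (cases "M \<subseteq> word_edges as bs")
    case True
    from snoc.IH[OF this snoc.prems(2,3)] show ?thesis
      unfolding height_snoc by (rule order_trans[OF _ extend_ge])
  next
    case False
    then obtain i where i: "i \<in> occ as c" "(Suc i, Suc (length bs)) \<in> M"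
      using snoc.prems(1) unfolding word_edges_snoc by blast
    define e where "e = (Suc i, Suc (length bs))"
    have nc: "fst f \<le> i \<and> snd f \<le> length bs" if "f \<in> M - {e}" for f
    proof -
      have "noncrossing e f"
        using snoc.prems(2)[unfolded planar_matching_altdef, rule_format, of e f] i(2) that
        by (auto simp: e_def)
      moreover have "snd f \<le> Suc (length bs)"
        using subsetD[OF snoc.prems(1), of f] that by (auto simp: word_edges_def)
      ultimately show ?thesis unfolding noncrossing_def e_def fst_conv snd_conv by linarith
    qed
    have "M - {e} \<subseteq> word_edges as bs"
    proof
      fix f assume f: "f \<in> M - {e}"
      with snoc.prems(1) have "f \<in> word_edges as bs \<union> (\<lambda>i. (Suc i, Suc (length bs))) ` occ as c"
        unfolding word_edges_snoc by blast
      with nc[OF f] show "f \<in> word_edges as bs" by auto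
    qed
    moreover have "planar_matching (M - {e})"
      using snoc.prems(2) unfolding planar_matching_altdef by blast
    moreover have "\<forall>f\<in>M - {e}. fst f \<le> i" using nc by blast
    ultimately have "card (M - {e}) \<le> height as bs (\<lambda>_. 0) i" by (rule snoc.IH)
    moreover have "card M = Suc (card (M - {e}))"
    proof (rule card.remove)
      show "finite M" using snoc.prems(1) finite_word_edges by (rule finite_subset)
    next
      show "e \<in> M" using i(2) by (simp only: e_def)
    qed
    moreover have "i < x" using bspec[OF snoc.prems(3) i(2)] by simp
    ultimately show ?thesis
      unfolding height_snoc using extend_ge_Suc[OF i(1) \<open>i < x\<close>, of "height as bs (\<lambda>_. 0)"] by linarith
  qed
qed

text \<open>Traces the maximum in \<open>extend\<close> back: whenever it is attained at a point i,
  the corresponding edge is added to a matching for the columns below i.\<close>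

lemma ex_planar_matching_height:
  "\<exists>M\<subseteq>word_edges as bs. planar_matching M \<and> (\<forall>e\<in>M. fst e \<le> x) \<and> card M = height as bs (\<lambda>_. 0) x"
proof (induction bs arbitrary: x rule: rev_induct)
  case Nil
  show ?case by (intro exI[of _ "{}"]) (auto simp: planar_matching_altdef)
next
  case (snoc c bs)
  show ?case
  proof (cases rule: extend_cases[of "occ as c" "height as bs (\<lambda>_. 0)" x])
    case 1
    with snoc.IH[of x] show ?thesis by (auto simp: height_snoc word_edges_snoc)
  next
    case (2 i)
    obtain M where M: "M \<subseteq> word_edges as bs" "planar_matching M" "\<forall>e\<in>M. fst e \<le> i"
      "card M = height as bs (\<lambda>_. 0) i" using snoc.IH[of i] by blast
    define e where "e = (Suc i, Suc (length bs))"
    have snd: "snd f \<le> length bs" if "f \<in> M" for f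
      using that M(1) by (auto simp: word_edges_def)
    have "noncrossing e f \<and> noncrossing f e" if "f \<in> M" for f
      using M(3) snd that by (auto simp: noncrossing_def e_def le_imp_less_Suc)
    then have "planar_matching (insert e M)"
      using M(2) unfolding planar_matching_altdef by blast
    moreover have "e \<notin> M" using snd[of e] by (auto simp: e_def)
    moreover have "finite M" using M(1) finite_word_edges by (rule finite_subset)
    moreover have "insert e M \<subseteq> word_edges as (bs @ [c])"
      using M(1) 2 by (auto simp: word_edges_snoc e_def)
    moreover have "\<forall>f\<in>insert e M. fst f \<le> x" using M(3) 2 by (auto simp: e_def)
    ultimately show ?thesis
      using M(4) 2 by (intro exI[of _ "insert e M"]) (simp add: height_snoc)
  qed
qed

lemma max_planar_matching_word_edges: "max_planar_matching (word_edges as bs) = lcs as bs"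
  unfolding max_planar_matching_def
proof (rule Max_eqI)
  show "finite {card M |M. M \<subseteq> word_edges as bs \<and> planar_matching M}"
    using finite_word_edges[of as bs] by simp
next
  fix m assume "m \<in> {card M |M. M \<subseteq> word_edges as bs \<and> planar_matching M}"
  then obtain M where M: "m = card M" "M \<subseteq> word_edges as bs" "planar_matching M" by blast
  have "\<forall>e\<in>M. fst e \<le> length as" using M(2) by (auto simp: word_edges_def)
  with M show "m \<le> lcs as bs" by (simp add: lcs_def card_planar_matching_le_height)
next
  show "lcs as bs \<in> {card M |M. M \<subseteq> word_edges as bs \<and> planar_matching M}"
    unfolding lcs_def mem_Collect_eq using ex_planar_matching_height[of as bs "length as"] by metis
qed

section \<open>Comparison with a word of distinct letters\<close>

text \<open>Letters start at 0, so that \<open>[0..<r]\<close> is a word of distinct letters in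
  which position and letter coincide.\<close>

abbreviation letter :: "nat \<Rightarrow> nat pmf" where
  "letter k \<equiv> pmf_of_set {..<k}"

lemma set_pmf_letter: "k \<ge> 1 \<Longrightarrow> set_pmf (letter k) = {..<k}"
  by (subst set_pmf_of_set) (auto simp: lessThan_empty_iff)

lemma expect_letter_Suc:
  assumes "k \<ge> 1"
  shows "expect_list (letter k) (Suc n) f = (\<Sum>c<k. expect_list (letter k) n (\<lambda>xs. f (c # xs))) / real k"
proof -
  have "pmf (letter k) c = 1 / real k" if "c < k" for c
    using that assms by (subst pmf_of_set) (auto simp: lessThan_empty_iff)
  then show ?thesis
    unfolding expect_list.simps set_pmf_letter[OF assms] by (simp add: sum_divide_distrib)
qed

lemma expect_letter_const: "k \<ge> 1 \<Longrightarrow> expect_list (letter k) n (\<lambda>_. a) = a"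
  by (rule expect_list_const) (simp add: set_pmf_letter)

lemma sum_occ:
  fixes as :: "nat list" and u :: "nat \<Rightarrow> real"
  assumes "\<And>i. 0 \<le> u i"
  shows "(\<Sum>c<k. \<Sum>i\<in>occ as c. u i) \<le> (\<Sum>i<length as. u i)"
proof -
  have "(\<Sum>c<k. \<Sum>i\<in>occ as c. u i) = (\<Sum>i\<in>(\<Union>c<k. occ as c). u i)"
    by (rule sum.UNION_disjoint[symmetric]) (auto simp: occ_def)
  also have "\<dots> \<le> (\<Sum>i<length as. u i)"
    using assms by (intro sum_mono2) (auto simp: occ_def)
  finally show ?thesis .
qed

text \<open>The gain of a row is at most the sum of the gains of its points by
  \<open>height_extend_cases\<close>, and each position of \<open>as\<close> is a point of at most
  one row. With distinct letters every row is a single point or empty and nothing is lost.\<close>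

lemma sum_extend_occ_le:
  fixes \<phi> :: "nat \<Rightarrow> real"
  assumes "mono \<phi>" "length as \<le> k"
  shows "(\<Sum>c<k. \<phi> (height zs bs (extend (occ as c) h) x))
    \<le> (\<Sum>c<k. \<phi> (height zs bs (extend (occ [0..<length as] c) h) x))"
proof -
  define r where "r = length as"
  define G where "G S = \<phi> (height zs bs (extend S h) x) - \<phi> (height zs bs h x)" for S
  have G0: "0 \<le> G S" for S
    unfolding G_def using monoD[OF assms(1) height_le[of x h "extend S h" zs bs]] by (simp add: extend_ge)
  have "G (occ as c) \<le> (\<Sum>i\<in>occ as c. G {i})" for c
  proof (cases rule: disjE[OF height_extend_cases[of "occ as c" zs bs h x, OF finite_occ]])
    case 1
    then show ?thesis using sum_nonneg[of "occ as c" "\<lambda>i. G {i}"] G0 by (simp add: G_def)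
  next
    case 2
    then obtain i where i: "i \<in> occ as c" "G (occ as c) = G {i}" by (auto simp: G_def)
    then show ?thesis using member_le_sum[of i "occ as c" "\<lambda>i. G {i}"] G0 by simp
  qed
  then have "(\<Sum>c<k. G (occ as c)) \<le> (\<Sum>c<k. \<Sum>i\<in>occ as c. G {i})" by (intro sum_mono)
  also have "\<dots> \<le> (\<Sum>i<r. G {i})" unfolding r_def by (rule sum_occ) (rule G0)
  also have "\<dots> = (\<Sum>c<r. G (occ [0..<r] c))" by simp
  also have "\<dots> \<le> (\<Sum>c<k. G (occ [0..<r] c))"
    using assms(2) G0 by (intro sum_mono2) (auto simp: r_def)
  finally show ?thesis by (simp add: G_def sum_subtractf r_def)
qed

text \<open>Rows are exchanged one by one: first the later ones by induction, for each fixed first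
  row, then the first one by \<open>sum_extend_occ_le\<close>. A general monotone \<phi> is carried
  along for the exponential moments.\<close>

lemma expect_height_le:
  fixes \<phi> :: "nat \<Rightarrow> real"
  assumes "mono \<phi>" "length as \<le> k" "k \<ge> 1"
  shows "expect_list (letter k) s (\<lambda>bs. \<phi> (height as bs h x))
    \<le> expect_list (letter k) s (\<lambda>bs. \<phi> (height [0..<length as] bs h x))"
proof (induction s arbitrary: h)
  case (Suc s)
  let ?id = "[0..<length as]"
  have "(\<Sum>c<k. expect_list (letter k) s (\<lambda>bs. \<phi> (height as bs (extend (occ as c) h) x)))
      \<le> (\<Sum>c<k. expect_list (letter k) s (\<lambda>bs. \<phi> (height ?id bs (extend (occ as c) h) x)))"
    by (intro sum_mono Suc)
  also have "\<dots> \<le> (\<Sum>c<k. expect_list (letter k) s (\<lambda>bs. \<phi> (height ?id bs (extend (occ ?id c) h) x)))"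
    unfolding expect_list_sum[symmetric]
    by (intro expect_list_mono sum_extend_occ_le assms)
  finally show ?case
    unfolding expect_letter_Suc[OF assms(3)] height_Cons by (intro divide_right_mono) auto
qed simp

corollary expect_lcs_le:
  fixes \<phi> :: "nat \<Rightarrow> real"
  assumes "mono \<phi>" "length as \<le> k" "k \<ge> 1"
  shows "expect_list (letter k) s (\<lambda>bs. \<phi> (lcs as bs))
    \<le> expect_list (letter k) s (\<lambda>bs. \<phi> (lcs [0..<length as] bs))"
  using expect_height_le[OF assms] by (simp add: lcs_def)

section \<open>Cost of repeated letters\<close>

definition repeated :: "'a list \<Rightarrow> nat set" where
  "repeated as = {i. i < length as \<and> occ as (as ! i) \<noteq> {i}}"

text \<open>A position whose letter occurs once produces the same one-point row as in the word of
  distinct letters. Each of the other positions loses at most 1, since a row raises the final height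
  by at most 1.\<close>

lemma sum_extend_occ_ge:
  assumes "mono h" "set as \<subseteq> {..<k}" "length as \<le> k"
  shows "(\<Sum>c<k. real (height zs bs (extend (occ [0..<length as] c) h) x))
    \<le> (\<Sum>c<k. real (height zs bs (extend (occ as c) h) x)) + card (repeated as)"
proof -
  define r where "r = length as"
  define G where "G S = real (height zs bs (extend S h) x) - real (height zs bs h x)" for S
  have G0: "0 \<le> G S" for S
    unfolding G_def using height_le[of x h "extend S h" zs bs] by (simp add: extend_ge)
  have G1: "G S \<le> 1" for S
    unfolding G_def using height_extend_le_Suc[OF assms(1), of zs bs S x] by linarith
  define U where "U = {..<r} - repeated as"
  have U: "occ as (as ! i) = {i}" if "i \<in> U" for i
    using that by (auto simp: U_def repeated_def r_def)
  have sub: "repeated as \<subseteq> {..<r}" by (auto simp: repeated_def r_def)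
  have "(\<Sum>c<k. G (occ [0..<r] c)) = (\<Sum>c<r. G (occ [0..<r] c))"
    using assms(3) by (intro sum.mono_neutral_right) (auto simp: r_def G_def)
  also have "\<dots> = (\<Sum>i\<in>U. G {i}) + (\<Sum>i\<in>repeated as. G {i})"
  proof -
    have "G (occ [0..<r] c) = G {c}" if "c < r" for c using that by simp
    then have "(\<Sum>c<r. G (occ [0..<r] c)) = (\<Sum>c<r. G {c})" by (intro sum.cong) simp_all
    also have "\<dots> = (\<Sum>i\<in>U. G {i}) + (\<Sum>i\<in>repeated as. G {i})"
      unfolding U_def by (rule sum.subset_diff[OF sub]) simp
    finally show ?thesis .
  qed
  also have "(\<Sum>i\<in>repeated as. G {i}) \<le> (\<Sum>i\<in>repeated as. 1)" by (intro sum_mono G1)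
  also have "(\<Sum>i\<in>U. G {i}) = (\<Sum>i\<in>U. G (occ as (as ! i)))" by (simp add: U)
  \<comment> \<open>Distinct positions in U carry distinct letters, because the occurrence set of
    the letter determines the position.\<close>
  also have "\<dots> = (\<Sum>c\<in>(!) as ` U. G (occ as c))"
    by (subst sum.reindex) (auto intro!: inj_onI dest!: U dest: arg_cong[of _ _ "occ as"])
  also have "\<dots> \<le> (\<Sum>c<k. G (occ as c))"
    using assms(2) G0 by (intro sum_mono2) (auto simp: U_def r_def dest: nth_mem)
  finally show ?thesis by (simp add: G_def sum_subtractf r_def)
qed

lemma expect_lcs_ge:
  assumes "set as \<subseteq> {..<k}" "length as \<le> k" "k \<ge> 1"
  shows "expect_list (letter k) s (\<lambda>bs. real (lcs [0..<length as] bs))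
    \<le> expect_list (letter k) s (\<lambda>bs. real (lcs as bs)) + real s * card (repeated as) / k"
proof -
  let ?id = "[0..<length as]"
  have "expect_list (letter k) s (\<lambda>bs. real (height ?id bs h x))
    \<le> expect_list (letter k) s (\<lambda>bs. real (height as bs h x)) + real s * card (repeated as) / k"
    if "mono h" for h x
    using that
  proof (induction s arbitrary: h)
    case (Suc s)
    let ?D = "real s * card (repeated as) / k"
    have "(\<Sum>c<k. expect_list (letter k) s (\<lambda>bs. real (height ?id bs (extend (occ ?id c) h) x)))
        = expect_list (letter k) s (\<lambda>bs. \<Sum>c<k. real (height ?id bs (extend (occ ?id c) h) x))"
      by (simp add: expect_list_sum)
    also have "\<dots> \<le> expect_list (letter k) s
        (\<lambda>bs. (\<Sum>c<k. real (height ?id bs (extend (occ as c) h) x)) + card (repeated as))"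
      by (intro expect_list_mono sum_extend_occ_ge assms Suc)
    also have "\<dots> = (\<Sum>c<k. expect_list (letter k) s (\<lambda>bs. real (height ?id bs (extend (occ as c) h) x)))
        + card (repeated as)"
      using assms(3) by (simp add: expect_list_sum expect_list_add expect_letter_const)
    also have "\<dots> \<le> (\<Sum>c<k. expect_list (letter k) s (\<lambda>bs. real (height as bs (extend (occ as c) h) x)) + ?D)
        + card (repeated as)"
      by (intro add_right_mono sum_mono Suc.IH mono_extend Suc.prems)
    also have "\<dots> = (\<Sum>c<k. expect_list (letter k) s (\<lambda>bs. real (height as bs (extend (occ as c) h) x)))
        + real (Suc s) * card (repeated as)"
      using assms(3) by (simp add: sum.distrib algebra_simps)
    finally show ?case
      unfolding expect_letter_Suc[OF assms(3)] height_Cons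
      using assms(3) by (simp add: divide_simps)
  qed simp
  from this[of "\<lambda>_. 0" "length as"] show ?thesis by (simp add: lcs_def mono_def)
qed

text \<open>Newly repeated are at most the occurrences of a in \<open>as\<close> and, if there are
  any, the front position itself; hence the factor 2.\<close>

lemma card_repeated_Cons: "card (repeated (a # as)) \<le> card (repeated as) + 2 * card (occ as a)"
proof -
  have "repeated (a # as) \<subseteq> (if occ as a = {} then {} else {0}) \<union> Suc ` repeated as \<union> Suc ` occ as a"
  proof
    fix i assume i: "i \<in> repeated (a # as)"
    have occ: "occ (a # as) c = (if a = c then {0} else {}) \<union> Suc ` occ as c" for c
    proof (rule set_eqI)
      fix i show "i \<in> occ (a # as) c \<longleftrightarrow> i \<in> (if a = c then {0} else {}) \<union> Suc ` occ as c"
        by (cases i) (auto simp: occ_def)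
    qed
    from i show "i \<in> (if occ as a = {} then {} else {0}) \<union> Suc ` repeated as \<union> Suc ` occ as a"
    proof (cases i)
      case 0
      with i have "occ as a \<noteq> {}" by (auto simp: repeated_def occ)
      with 0 show ?thesis by simp
    next
      case (Suc j)
      with i have j: "j < length as" "occ (a # as) (as ! j) \<noteq> {Suc j}" by (simp_all add: repeated_def)
      show ?thesis
      proof (cases "a = as ! j")
        case True
        with j have "j \<in> occ as a" by (simp add: occ_def)
        with Suc show ?thesis by simp
      next
        case False
        with j have "j \<in> repeated as" by (auto simp: repeated_def occ)
        with Suc show ?thesis by simp
      qed
    qed
  qed
  then have "card (repeated (a # as)) \<le>
      card ((if occ as a = {} then {} else {0}) \<union> Suc ` repeated as \<union> Suc ` occ as a)"
    by (intro card_mono) (auto simp: repeated_def)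
  also have "\<dots> \<le> card (if occ as a = {} then {} else {0::nat}) + card (Suc ` repeated as) + card (Suc ` occ as a)"
    by (intro order_trans[OF card_Un_le] add_mono order_refl card_Un_le)
  also have "\<dots> \<le> card (occ as a) + card (repeated as) + card (occ as a)"
    by (intro add_mono) (auto simp: card_image Suc_leI card_gt_0_iff)
  finally show ?thesis by simp
qed

text \<open>A uniform letter put in front adds at most 2 r / k on average, and r^2 + 2 r \<le> (r +
  1)^2.\<close>

lemma expect_card_repeated:
  assumes "k \<ge> 1"
  shows "expect_list (letter k) r (\<lambda>as. real (card (repeated as))) \<le> real r ^ 2 / k"
proof (induction r)
  case (Suc r)
  have occ: "(\<Sum>c<k. real (card (occ as c))) \<le> real (length as)" for as :: "nat list"
    using sum_occ[of "\<lambda>_. 1" as k] by simp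
  have "(\<Sum>c<k. real (card (repeated (c # as)))) \<le> k * card (repeated as) + 2 * real r"
    if "length as = r" for as :: "nat list"
  proof -
    have "(\<Sum>c<k. real (card (repeated (c # as)))) \<le> (\<Sum>c<k. card (repeated as) + 2 * real (card (occ as c)))"
    proof (rule sum_mono)
      fix c show "real (card (repeated (c # as))) \<le> card (repeated as) + 2 * real (card (occ as c))"
        using of_nat_mono[OF card_repeated_Cons[of c as], where 'a = real] by simp
    qed
    also have "\<dots> \<le> k * card (repeated as) + 2 * real r"
      using occ[of as] that by (simp add: sum.distrib flip: sum_distrib_left)
    finally show ?thesis .
  qed
  then have "expect_list (letter k) r (\<lambda>as. \<Sum>c<k. real (card (repeated (c # as))))
      \<le> expect_list (letter k) r (\<lambda>as. k * card (repeated as) + 2 * real r)"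
    by (intro expect_list_mono)
  also have "\<dots> \<le> k * (real r ^ 2 / k) + 2 * real r"
    using Suc assms by (simp add: expect_list_add expect_list_cmult expect_letter_const divide_simps mult.commute)
  also have "\<dots> \<le> real (Suc r) ^ 2" using assms by (simp add: power2_eq_square algebra_simps)
  finally show ?case
    unfolding expect_letter_Suc[OF assms] expect_list_sum by (intro divide_right_mono) auto
qed (simp add: repeated_def)

section \<open>Stationary process with sources and sinks\<close>

abbreviation site :: "nat \<Rightarrow> bool pmf" where
  "site d \<equiv> bernoulli_pmf (1 / (real d + 1))"

lemma set_pmf_site: "d \<ge> 1 \<Longrightarrow> set_pmf (site d) = UNIV"
  by (rule set_pmf_bernoulli) (auto simp: field_simps)

lemma expect_site_Suc:
  assumes "d \<ge> 1"
  shows "expect_list (site d) (Suc n) f =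
    (expect_list (site d) n (\<lambda>xs. f (True # xs)) + d * expect_list (site d) n (\<lambda>xs. f (False # xs))) / (real d + 1)"
proof -
  have "1 - 1 / (real d + 1) = d / (real d + 1)" by (simp add: field_simps)
  then show ?thesis
    using assms unfolding expect_list.simps set_pmf_site[OF assms] UNIV_bool
    by (simp add: add_divide_distrib)
qed

lemma expect_site_const: "d \<ge> 1 \<Longrightarrow> expect_list (site d) n (\<lambda>_. a) = a"
  by (rule expect_list_const) (simp add: set_pmf_site)

text \<open>A list of sites encodes a profile by its increments, \<open>True\<close> being a
  particle, that is a unit step; \<open>sources x\<close> reads off the profile at x. A sink deletes
  the first particle.\<close>

fun drop_first :: "bool list \<Rightarrow> bool list" where
  "drop_first [] = []"
| "drop_first (b # \<eta>) = False # (if b then \<eta> else drop_first \<eta>)"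

text \<open>Hammersley dynamics: the first particle at or right of c jumps to c, and if there is
  none a new particle enters at c.\<close>

fun hit :: "nat \<Rightarrow> bool list \<Rightarrow> bool list" where
  "hit c [] = []"
| "hit 0 (b # \<eta>) = True # (if b then \<eta> else drop_first \<eta>)"
| "hit (Suc c) (b # \<eta>) = b # hit c \<eta>"

text \<open>
  The \<open>d\<close> letters after the sites act as sinks: an integer odds ratio \<open>d\<close> makes the sink rate \<open>d/k\<close>
  required by stationarity available within the alphabet.
\<close>

definition step :: "nat \<Rightarrow> nat \<Rightarrow> bool list \<Rightarrow> bool list" where
  "step d c \<eta> = (if c < length \<eta> then hit c \<eta> else if c < length \<eta> + d then drop_first \<eta> else \<eta>)"

abbreviation sources :: "nat \<Rightarrow> bool list \<Rightarrow> nat" where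
  "sources x \<eta> \<equiv> length (filter (\<lambda>b. b) (take x \<eta>))"

abbreviation sinks :: "nat \<Rightarrow> nat \<Rightarrow> nat list \<Rightarrow> nat" where
  "sinks r d bs \<equiv> length (filter (\<lambda>c. c \<in> {r..<r + d}) bs)"

lemma length_drop_first [simp]: "length (drop_first \<eta>) = length \<eta>"
  by (induction \<eta>) auto

lemma length_hit [simp]: "length (hit c \<eta>) = length \<eta>"
  by (induction c \<eta> rule: hit.induct) auto

lemma length_step [simp]: "length (step d c \<eta>) = length \<eta>"
  by (simp add: step_def)

lemma length_fold_step [simp]: "length (fold (step d) bs \<eta>) = length \<eta>"
  by (induction bs arbitrary: \<eta>) simp_all

text \<open>Stationarity of the product measure, by induction on the sites. The new first site is
  empty with odds d to 1, so the \<open>drop_first\<close> terms it creates have weight d and cancel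
  those that the induction hypothesis leaves over.\<close>

lemma expect_hit_drop_first:
  assumes "d \<ge> 1"
  shows "(\<Sum>c<r. expect_list (site d) r (\<lambda>\<eta>. f (hit c \<eta>))) + d * expect_list (site d) r (\<lambda>\<eta>. f (drop_first \<eta>))
    = (real r + d) * expect_list (site d) r f"
proof (induction r arbitrary: f)
  case (Suc r)
  let ?T = "\<lambda>\<eta>. f (True # \<eta>)" and ?F = "\<lambda>\<eta>. f (False # \<eta>)"
  let ?E = "expect_list (site d) r"
  have "(real d + 1) * (\<Sum>c<r. expect_list (site d) (Suc r) (\<lambda>\<eta>. f (hit (Suc c) \<eta>)))
      = (\<Sum>c<r. ?E (\<lambda>\<eta>. ?T (hit c \<eta>))) + d * (\<Sum>c<r. ?E (\<lambda>\<eta>. ?F (hit c \<eta>)))"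
    by (simp add: expect_site_Suc[OF assms] sum.distrib sum_distrib_left flip: sum_divide_distrib del: expect_list.simps)
  also have "\<dots> = (real r + d) * ?E ?T - d * ?E (\<lambda>\<eta>. ?T (drop_first \<eta>))
      + d * ((real r + d) * ?E ?F - d * ?E (\<lambda>\<eta>. ?F (drop_first \<eta>)))"
    using Suc[of ?T] Suc[of ?F] unfolding eq_diff_eq[symmetric] by simp
  finally have *: "(\<Sum>c<r. expect_list (site d) (Suc r) (\<lambda>\<eta>. f (hit (Suc c) \<eta>)))
      = ((real r + d) * ?E ?T - d * ?E (\<lambda>\<eta>. ?T (drop_first \<eta>))
      + d * ((real r + d) * ?E ?F - d * ?E (\<lambda>\<eta>. ?F (drop_first \<eta>)))) / (real d + 1)"
    by (simp add: field_simps)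
  show ?case
    unfolding sum.lessThan_Suc_shift * unfolding expect_site_Suc[OF assms]
    by (simp add: divide_simps) (simp add: algebra_simps)
qed simp

lemma expect_step:
  assumes "d \<ge> 1" "r + d \<le> k"
  shows "(\<Sum>c<k. expect_list (site d) r (\<lambda>\<eta>. f (step d c \<eta>))) = real k * expect_list (site d) r f"
proof -
  let ?E = "expect_list (site d) r"
  have U: "{..<k} = {..<r} \<union> {r..<r+d} \<union> {r+d..<k}" using assms by auto
  have "(\<Sum>c<k. ?E (\<lambda>\<eta>. f (step d c \<eta>))) =
     (\<Sum>c<k. if c < r then ?E (\<lambda>\<eta>. f (hit c \<eta>)) else if c < r + d then ?E (\<lambda>\<eta>. f (drop_first \<eta>)) else ?E f)"
    by (intro sum.cong refl) (auto simp: step_def intro!: expect_list_cong)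
  also have "(\<Sum>c<k. if c < r then ?E (\<lambda>\<eta>. f (hit c \<eta>))
      else if c < r + d then ?E (\<lambda>\<eta>. f (drop_first \<eta>)) else ?E f)
    = (\<Sum>c<r. ?E (\<lambda>\<eta>. f (hit c \<eta>))) + d * ?E (\<lambda>\<eta>. f (drop_first \<eta>)) + real (k - (r + d)) * ?E f"
    unfolding U by (subst sum.union_disjoint, simp, simp, force, subst sum.union_disjoint) auto
  also have "\<dots> = real k * ?E f"
    unfolding expect_hit_drop_first[OF assms(1)] using assms(2)
    by (simp add: of_nat_diff algebra_simps)
  finally show ?thesis .
qed

lemma expect_fold_step:
  assumes "d \<ge> 1" "r + d \<le> k"
  shows "expect_list (site d) r (\<lambda>\<eta>. expect_list (letter k) s (\<lambda>bs. f (fold (step d) bs \<eta>)))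
    = expect_list (site d) r f"
proof (induction s)
  case (Suc s)
  have k: "k \<ge> 1" using assms by linarith
  have "expect_list (site d) r (\<lambda>\<eta>. expect_list (letter k) (Suc s) (\<lambda>bs. f (fold (step d) bs \<eta>)))
    = (\<Sum>c<k. expect_list (site d) r (\<lambda>\<eta>. expect_list (letter k) s (\<lambda>bs. f (fold (step d) bs (step d c \<eta>))))) / k"
    unfolding expect_letter_Suc[OF k]
    by (simp add: expect_list_sum divide_inverse mult.commute[of _ "inverse (real k)"] expect_list_cmult)
  also have "\<dots> = expect_list (site d) r f"
    using expect_step[OF assms, of "\<lambda>\<eta>. expect_list (letter k) s (\<lambda>bs. f (fold (step d) bs \<eta>))"] Suc k
    by simp
  finally show ?case .
qed simp

lemma extend_singleton: "extend {c} h x = (if c < x then max (h x) (Suc (h c)) else h x)"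
proof -
  have "{i \<in> {c}. i < x} = (if c < x then {c} else {})" by auto
  then show ?thesis by (simp add: extend_def)
qed

text \<open>Truncated subtraction is intended: columns before the first particle keep the value
  0.\<close>

lemma sources_drop_first: "sources x (drop_first \<eta>) = sources x \<eta> - 1"
  by (induction \<eta> arbitrary: x) (auto simp: take_Cons split: nat.split)

text \<open>On a profile with steps 0 or 1 a single point at c raises the values by 1 from just
  right of c up to the next step, which moves that step to c.\<close>

lemma sources_hit: "c < length \<eta> \<Longrightarrow> sources x (hit c \<eta>) = extend {c} (\<lambda>y. sources y \<eta>) x"
proof (induction c \<eta> arbitrary: x rule: hit.induct)
  case (2 b \<eta>)
  show ?case by (cases x) (auto simp: extend_singleton sources_drop_first)
next
  case (3 c b \<eta>)
  then show ?case by (cases x) (auto simp: extend_singleton)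
qed simp

text \<open>A sink lowers the profile by at most 1 and is counted once in \<open>sinks\<close>, so
  the total never falls below the true height. In the induction m collects the sinks already
  met.\<close>

lemma lcs_le_sinks_sources:
  assumes "length \<eta> = r"
  shows "lcs [0..<r] bs \<le> sinks r d bs + sources r (fold (step d) bs \<eta>)"
proof -
  have "height [0..<r] bs h x \<le> m + sinks r d bs + sources x (fold (step d) bs \<eta>)"
    if "\<And>x. h x \<le> m + sources x \<eta>" "length \<eta> = r" for h x m
    using that
  proof (induction bs arbitrary: h m \<eta>)
    case (Cons c bs)
    consider "c < r" | "r \<le> c" "c < r + d" | "r + d \<le> c" by linarith
    then show ?case
    proof cases
      case 1
      have "extend {c} h y \<le> m + sources y (hit c \<eta>)" for y
        using extend_mono[of y h "\<lambda>y. m + sources y \<eta>" "{c}"] Cons.prems 1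
        by (simp add: sources_hit extend_shift)
      from Cons.IH[OF this] show ?thesis using Cons.prems 1 by (simp add: step_def)
    next
      case 2
      have "h y \<le> Suc m + sources y (drop_first \<eta>)" for y
        using Cons.prems(1)[of y] unfolding sources_drop_first by linarith
      from Cons.IH[OF this] show ?thesis using Cons.prems 2 by (simp add: step_def)
    next
      case 3
      from Cons.IH[OF Cons.prems] show ?thesis using Cons.prems 3 by (simp add: step_def)
    qed
  qed simp
  from this[of "\<lambda>_. 0" 0 r] show ?thesis using assms by (simp add: lcs_def)
qed

lemma height_snoc_ge: "height as bs h x \<le> height as (bs @ [c]) h x"
  by (simp add: height_snoc extend_ge)

text \<open>Exit point of a maximal chain: it follows the boundary, collecting sources up to a
  column z or sinks up to a row w, and is then an ordinary common subsequence of what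
  remains.\<close>

lemma sinks_sources_exit:
  assumes "length \<eta> = r"
  obtains z where "z \<le> r"
      "sinks r d bs + sources r (fold (step d) bs \<eta>) \<le> sources z \<eta> + lcs [z..<r] bs"
  | w where "w \<le> length bs"
      "sinks r d bs + sources r (fold (step d) bs \<eta>) \<le> sinks r d (take w bs) + lcs [0..<r] (drop w bs)"
proof -
  have "(\<exists>z\<le>x. sinks r d bs + sources x (fold (step d) bs \<eta>) \<le> sources z \<eta> + height [z..<r] bs (\<lambda>_. 0) (x - z)) \<or>
    (\<exists>w\<le>length bs. sinks r d bs + sources x (fold (step d) bs \<eta>)
      \<le> sinks r d (take w bs) + height [0..<r] (drop w bs) (\<lambda>_. 0) x)" (is "?P bs x") if "x \<le> r" for x
    using that
  proof (induction bs arbitrary: x rule: rev_induct)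
    case Nil
    then show ?case by (intro disjI1 exI[of _ x]) simp
  next
    case (snoc c bs)
    let ?\<eta> = "fold (step d) bs \<eta>"
    \<comment> \<open>A row that does not increase the total keeps the exit point of the earlier
      rows.\<close>
    have same: "?P (bs @ [c]) x"
      if "sinks r d (bs @ [c]) + sources x (fold (step d) (bs @ [c]) \<eta>) \<le> sinks r d bs + sources x ?\<eta>"
      using snoc.IH[OF snoc.prems]
    proof (elim disjE exE conjE)
      fix z assume z: "z \<le> x" "sinks r d bs + sources x ?\<eta> \<le> sources z \<eta> + height [z..<r] bs (\<lambda>_. 0) (x - z)"
      show ?thesis
        by (rule disjI1, rule exI[of _ z], intro conjI)
          (use z that height_snoc_ge[of "[z..<r]" bs "\<lambda>_. 0" "x - z" c] in linarith)+
    next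
      fix w assume w: "w \<le> length bs" "sinks r d bs + sources x ?\<eta>
        \<le> sinks r d (take w bs) + height [0..<r] (drop w bs) (\<lambda>_. 0) x"
      then have "take w (bs @ [c]) = take w bs" "drop w (bs @ [c]) = drop w bs @ [c]" by simp_all
      with w that height_snoc_ge[of "[0..<r]" "drop w bs" "\<lambda>_. 0" x c] show ?thesis
        by (intro disjI2 exI[of _ w]) (simp del: fold_append filter_append)
    qed
    consider "c < r" | "r \<le> c" "c < r + d" | "r + d \<le> c" by linarith
    then show ?case
    proof cases
      case 1
      then have src: "sources x (fold (step d) (bs @ [c]) \<eta>) = extend {c} (\<lambda>y. sources y ?\<eta>) x"
        and snk: "sinks r d (bs @ [c]) = sinks r d bs"
        using assms by (simp_all add: step_def sources_hit)
      show ?thesis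
      proof (cases rule: extend_cases[of "{c}" "\<lambda>y. sources y ?\<eta>" x])
        case 1
        then show ?thesis by (intro same) (simp only: src snk)
      next
        case (2 i)
        then have c: "c < x" and src': "sources x (fold (step d) (bs @ [c]) \<eta>) = Suc (sources c ?\<eta>)"
          using src by auto
        \<comment> \<open>The maximal chain ends in the new point c, so the exit point is taken from
          column c instead of x.\<close>
        from snoc.prems c have "c \<le> r" by simp
        from snoc.IH[OF this] show ?thesis
        proof (elim disjE exE conjE)
          fix z assume z: "z \<le> c" "sinks r d bs + sources c ?\<eta> \<le> sources z \<eta> + height [z..<r] bs (\<lambda>_. 0) (c - z)"
          have "c - z \<in> occ [z..<r] c" using z c snoc.prems by (auto simp: occ_def)
          then have "Suc (height [z..<r] bs (\<lambda>_. 0) (c - z)) \<le> height [z..<r] (bs @ [c]) (\<lambda>_. 0) (x - z)"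
            unfolding height_snoc using z c by (intro extend_ge_Suc) auto
          with z c src' snk show ?thesis
            by (intro disjI1 exI[of _ z]) (simp del: fold_append filter_append)
        next
          fix w assume w: "w \<le> length bs" "sinks r d bs + sources c ?\<eta>
            \<le> sinks r d (take w bs) + height [0..<r] (drop w bs) (\<lambda>_. 0) c"
          have "Suc (height [0..<r] (drop w bs) (\<lambda>_. 0) c) \<le> height [0..<r] (drop w bs @ [c]) (\<lambda>_. 0) x"
            unfolding height_snoc using 1 c \<open>c < r\<close> by (intro extend_ge_Suc) auto
          moreover from w have "take w (bs @ [c]) = take w bs" "drop w (bs @ [c]) = drop w bs @ [c]"
            by simp_all
          ultimately show ?thesis using w src' snk
            by (intro disjI2 exI[of _ w]) (simp del: fold_append filter_append)
        qed
      qed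
    next
      case 2
      then have src: "sources x (fold (step d) (bs @ [c]) \<eta>) = sources x ?\<eta> - 1"
        using assms by (simp add: step_def sources_drop_first)
      show ?thesis
      proof (cases "sources x ?\<eta> = 0")
        \<comment> \<open>With no particle left of x the total consists of sinks only, and the exit
          comes after the last row.\<close>
        case True
        with src show ?thesis by (intro disjI2 exI[of _ "Suc (length bs)"]) simp
      next
        \<comment> \<open>The new sink and the deleted particle compensate each other.\<close>
        case False
        with src 2 show ?thesis by (intro same) simp
      qed
    next
      case 3
      with assms show ?thesis by (intro same) (simp add: step_def)
    qed
  qed
  from this[of r] that show ?thesis by (auto simp: lcs_def)
qed

section \<open>Upper bound\<close>

lemma exp_midpoint_le: "exp ((u + v) / 2) \<le> (exp u + exp v) / (2 :: real)"
proof -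
  have "0 \<le> (exp (u / 2) - exp (v / 2))\<^sup>2" by simp
  also have "\<dots> = exp u + exp v - 2 * exp ((u + v) / 2)"
    by (simp add: power2_eq_square algebra_simps flip: exp_add)
  finally show ?thesis by simp
qed

lemma expect_list_multc: "expect_list p n (\<lambda>xs. f xs * a) = expect_list p n f * a"
  using expect_list_cmult[of p n a f] by (simp add: mult.commute)

lemma expect_list_take:
  assumes "finite (set_pmf p)" "m \<le> n"
  shows "expect_list p n (\<lambda>xs. f (take m xs)) = expect_list p m f"
proof -
  have "expect_list p (m + (n - m)) (\<lambda>xs. f (take m xs)) =
      expect_list p m (\<lambda>xs. expect_list p (n - m) (\<lambda>ys. f xs))"
    unfolding expect_list_append by (intro expect_list_cong) simp
  then show ?thesis using assms by (simp add: expect_list_const)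
qed

lemma expect_list_take_drop:
  assumes "m \<le> n"
  shows "expect_list p n (\<lambda>xs. f (take m xs) * g (drop m xs)) = expect_list p m f * expect_list p (n - m) g"
proof -
  have "expect_list p (m + (n - m)) (\<lambda>xs. f (take m xs) * g (drop m xs)) =
      expect_list p m (\<lambda>xs. expect_list p (n - m) (\<lambda>ys. f xs * g ys))"
    unfolding expect_list_append by (intro expect_list_cong) simp
  also have "\<dots> = expect_list p (n - m) g * expect_list p m f"
    by (simp add: expect_list_cmult expect_list_multc)
  finally show ?thesis using assms by (simp add: mult.commute)
qed

lemma sum_pmf_sinks:
  fixes k r d :: nat
  assumes "k \<ge> 1" "r + d \<le> k"
  shows "(\<Sum>c\<in>{c\<in>set_pmf (letter k). c \<in> {r..<r + d}}. pmf (letter k) c) = d / k"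
proof -
  have "{c\<in>set_pmf (letter k). c \<in> {r..<r + d}} = {r..<r + d}"
    using assms by (auto simp: set_pmf_letter)
  moreover have "pmf (letter k) c = 1 / real k" if "c \<in> {r..<r + d}" for c
    using that assms by (subst pmf_of_set) (auto simp: lessThan_empty_iff)
  ultimately show ?thesis by simp
qed

lemma sum_pmf_site: "(\<Sum>b\<in>{b\<in>set_pmf (site d). b}. pmf (site d) b) = 1 / (real d + 1)"
proof -
  have "(\<Sum>b\<in>{b\<in>set_pmf (site d). b}. pmf (site d) b) = (\<Sum>b\<in>{True}. pmf (site d) b)"
    by (rule sum.mono_neutral_left) (auto simp: set_pmf_iff)
  then show ?thesis by simp
qed

lemma expect_exp_sinks:
  fixes t :: real
  assumes "k \<ge> 1" "r + d \<le> k"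
  shows "expect_list (letter k) s (\<lambda>bs. exp (t * sinks r d bs)) \<le> exp (s * ((exp t - 1) * (d / k)))"
  using expect_list_exp_filter[of "letter k" s t "\<lambda>c. c \<in> {r..<r + d}"]
  unfolding sum_pmf_sinks[OF assms] by (simp add: set_pmf_letter[OF assms(1)])

lemma expect_sinks:
  assumes "k \<ge> 1" "r + d \<le> k"
  shows "expect_list (letter k) s (\<lambda>bs. real (sinks r d bs)) = s * (d / k)"
  using expect_list_length_filter[of "letter k" s "\<lambda>c. c \<in> {r..<r + d}"]
  unfolding sum_pmf_sinks[OF assms] by (simp add: set_pmf_letter[OF assms(1)])

lemma expect_exp_sources:
  fixes t :: real
  assumes "d \<ge> 1" "z \<le> r"
  shows "expect_list (site d) r (\<lambda>\<eta>. exp (t * sources z \<eta>)) \<le> exp (z * ((exp t - 1) / (real d + 1)))"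
  using expect_list_exp_filter[of "site d" z t "\<lambda>b. b"]
    expect_list_take[of "site d" z r "\<lambda>\<eta>. exp (t * length (filter (\<lambda>b. b) \<eta>))"] assms(2)
  unfolding sum_pmf_site by (simp add: set_pmf_site[OF assms(1)])

lemma expect_sources:
  assumes "d \<ge> 1" "z \<le> r"
  shows "expect_list (site d) r (\<lambda>\<eta>. real (sources z \<eta>)) = z / (real d + 1)"
  using expect_list_length_filter[of "site d" z "\<lambda>b. b"]
    expect_list_take[of "site d" z r "\<lambda>\<eta>. real (length (filter (\<lambda>b. b) \<eta>))"] assms(2)
  unfolding sum_pmf_site by (simp add: set_pmf_site[OF assms(1)])

text \<open>
  The two summands are dependent, each with an explicit law; the inequality between arithmetic and
  geometric mean decouples them at a cost of second order in \<open>t\<close>.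
\<close>

lemma expect_exp_stationary:
  fixes t :: real
  assumes "d \<ge> 1" "r + d \<le> k"
  shows "expect_list (site d) r (\<lambda>\<eta>. expect_list (letter k) s
      (\<lambda>bs. exp (t * (sinks r d bs + sources r (fold (step d) bs \<eta>)))))
    \<le> exp ((exp (2 * t) - 1) / 2 * (r / (real d + 1) + s * (d / k)))"
proof -
  have k: "k \<ge> 1" using assms by linarith
  define A where "A = r * ((exp (2 * t) - 1) / (real d + 1))"
  define B where "B = s * ((exp (2 * t) - 1) * (d / k))"
  let ?X = "\<lambda>\<eta> bs. sources r (fold (step d) bs \<eta>)"
  \<comment> \<open>The weights balance the two terms: with moments bounded by exp A and exp B, each
    contributes exp ((A + B) / 2) / 2.\<close>
  let ?a = "exp ((B - A) / 2) / 2" and ?b = "exp ((A - B) / 2) / 2"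
  let ?E = "\<lambda>f. expect_list (site d) r (\<lambda>\<eta>. expect_list (letter k) s (f \<eta>))"
  have "exp (t * (sinks r d bs + ?X \<eta> bs)) \<le> ?a * exp (2 * t * ?X \<eta> bs) + ?b * exp (2 * t * sinks r d bs)" for \<eta> bs
  proof -
    define u v where "u = real (?X \<eta> bs)" and "v = real (sinks r d bs)"
    have "exp (t * (v + u)) = exp (((2 * t * u + (B - A) / 2) + (2 * t * v + (A - B) / 2)) / 2)"
      by (simp add: field_simps)
    also have "\<dots> \<le> (exp (2 * t * u + (B - A) / 2) + exp (2 * t * v + (A - B) / 2)) / 2"
      by (rule exp_midpoint_le)
    also have "\<dots> = ?a * exp (2 * t * u) + ?b * exp (2 * t * v)"
      by (simp only: exp_add) simp
    finally show ?thesis by (simp add: u_def v_def)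
  qed
  then have "?E (\<lambda>\<eta> bs. exp (t * (sinks r d bs + ?X \<eta> bs)))
      \<le> ?E (\<lambda>\<eta> bs. ?a * exp (2 * t * ?X \<eta> bs) + ?b * exp (2 * t * sinks r d bs))"
    by (intro expect_list_mono)
  also have "\<dots> = ?a * ?E (\<lambda>\<eta> bs. exp (2 * t * ?X \<eta> bs))
      + ?b * expect_list (letter k) s (\<lambda>bs. exp (2 * t * sinks r d bs))"
    by (simp only: expect_list_add expect_list_cmult expect_site_const[OF assms(1)])
  \<comment> \<open>By stationarity the final configuration has the law of the initial one.\<close>
  also have "?E (\<lambda>\<eta> bs. exp (2 * t * ?X \<eta> bs)) = expect_list (site d) r (\<lambda>\<eta>. exp (2 * t * sources r \<eta>))"
    using expect_fold_step[OF assms, of s "\<lambda>\<eta>. exp (2 * t * sources r \<eta>)"] by simp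
  also have "\<dots> \<le> exp A"
    using expect_exp_sources[OF assms(1) order_refl[of r], of "2 * t"] by (simp add: A_def)
  also have "expect_list (letter k) s (\<lambda>bs. exp (2 * t * sinks r d bs)) \<le> exp B"
    using expect_exp_sinks[OF k assms(2), of s "2 * t"] by (simp add: B_def)
  also have "?a * exp A + ?b * exp B = exp ((A + B) / 2)"
    by (simp add: algebra_simps add_divide_distrib diff_divide_distrib flip: exp_add)
  also have "(A + B) / 2 = (exp (2 * t) - 1) / 2 * (r / (real d + 1) + s * (d / k))"
  proof -
    have "(x * (e / y) + z * (e * q)) / 2 = e / 2 * (x / y + z * q)" for x y z e q :: real
      by (simp add: algebra_simps add_divide_distrib)
    then show ?thesis unfolding A_def B_def .
  qed
  finally show ?thesis by simp
qed

text \<open>Three reductions: to a word of distinct letters, to an average over an auxiliary initial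
  configuration, and to the length with sources and sinks. The exponent is linear in s, which makes
  summing over cut points possible.\<close>

lemma expect_exp_lcs_le:
  fixes t :: real
  assumes "d \<ge> 1" "length as + d \<le> k" "t \<ge> 0"
  shows "expect_list (letter k) s (\<lambda>bs. exp (t * lcs as bs))
    \<le> exp ((exp (2 * t) - 1) / 2 * (length as / (real d + 1) + s * (d / k)))"
proof -
  define r where "r = length as"
  have k: "k \<ge> 1" using assms by linarith
  have "expect_list (letter k) s (\<lambda>bs. exp (t * lcs as bs)) \<le> expect_list (letter k) s (\<lambda>bs. exp (t * lcs [0..<r] bs))"
    unfolding r_def using assms
    by (intro expect_lcs_le[where \<phi> = "\<lambda>n. exp (t * real n)"] k) (auto intro!: monoI mult_left_mono)
  also have "\<dots> = expect_list (site d) r (\<lambda>\<eta>. expect_list (letter k) s (\<lambda>bs. exp (t * lcs [0..<r] bs)))"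
    by (simp add: expect_site_const[OF assms(1)])
  also have "\<dots> \<le> expect_list (site d) r (\<lambda>\<eta>. expect_list (letter k) s
      (\<lambda>bs. exp (t * (sinks r d bs + sources r (fold (step d) bs \<eta>)))))"
    using assms(3) lcs_le_sinks_sources
    by (intro expect_list_mono) (simp add: mult_left_mono flip: of_nat_add del: expect_list.simps)
  also have "\<dots> \<le> exp ((exp (2 * t) - 1) / 2 * (r / (real d + 1) + s * (d / k)))"
    using assms by (intro expect_exp_stationary) (auto simp: r_def)
  finally show ?thesis by (simp add: r_def)
qed

lemma sum_exp_le:
  assumes "\<epsilon> > 0"
  shows "(\<Sum>j\<le>s. exp (- (\<epsilon> * real (s - j)))) \<le> 1 / (1 - exp (- \<epsilon>))"
proof -
  have "(\<Sum>j\<le>s. exp (- (\<epsilon> * real (s - j)))) = (\<Sum>j\<le>s. exp (- \<epsilon>) ^ (s - j))"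
    by (simp add: mult.commute flip: exp_of_nat_mult)
  also have "\<dots> = (\<Sum>j\<le>s. exp (- \<epsilon>) ^ j)"
    by (rule sum.nat_diff_reindex[of "\<lambda>j. exp (- \<epsilon>) ^ j" "Suc s", simplified lessThan_Suc_atMost diff_Suc_Suc, simplified])
  also have "\<dots> = (1 - exp (- \<epsilon>) ^ Suc s) / (1 - exp (- \<epsilon>))"
    using assms sum_gp0[of "exp (- \<epsilon>)" s] by simp
  also have "\<dots> \<le> 1 / (1 - exp (- \<epsilon>))" using assms by (intro divide_right_mono) auto
  finally show ?thesis .
qed

text \<open>One piece of length r is split off at a time, with a sum over the cut point j of bs. The
  surplus \<epsilon> per scanned letter turns that sum into a geometric series, so each piece costs
  a factor independent of s.\<close>

lemma expect_exp_lcs_long_le: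
  fixes t \<epsilon> :: real
  defines "c \<equiv> (exp (2 * t) - 1) / 2"
  assumes "d \<ge> 1" "r + d \<le> k" "t \<ge> 0" "\<epsilon> > 0" "length as = m * r"
  shows "expect_list (letter k) s (\<lambda>bs. exp (t * lcs as bs))
    \<le> (1 / (1 - exp (- \<epsilon>))) ^ m * exp (c * (real m * real r / (real d + 1)) + (c * (d / k) + \<epsilon>) * s)"
  using assms(6)
proof (induction m arbitrary: as s)
  case 0
  have "lcs [] bs = 0" for bs :: "nat list"
  proof -
    have "height [] bs (\<lambda>_. 0) 0 = 0" by (induction bs) (simp_all add: occ_def)
    then show ?thesis by (simp add: lcs_def)
  qed
  moreover have "k \<ge> 1" "0 \<le> c" using assms by (auto simp: c_def)
  ultimately show ?case using 0 assms by (simp add: expect_letter_const)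
next
  case (Suc m)
  define K where "K = 1 / (1 - exp (- \<epsilon>))"
  have K0: "K > 0" using assms by (simp add: K_def)
  define as1 as2 where "as1 = take (m * r) as" and "as2 = drop (m * r) as"
  have as: "as = as1 @ as2" "length as1 = m * r" "length as2 = r"
    using Suc.prems by (simp_all add: as1_def as2_def)
  let ?E = "\<lambda>s. expect_list (letter k) s"
  have "exp (t * lcs as bs) \<le> (\<Sum>j\<le>s. exp (t * lcs as1 (take j bs)) * exp (t * lcs as2 (drop j bs)))"
    if len: "length bs = s" for bs
  proof -
    from lcs_append_le[of bs as1 as2] obtain j where j: "j \<le> s"
      "lcs as bs \<le> lcs as1 (take j bs) + lcs as2 (drop j bs)" using len as by auto
    then have "t * lcs as bs \<le> t * (lcs as1 (take j bs) + lcs as2 (drop j bs))"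
      using assms by (intro mult_left_mono) (auto simp flip: of_nat_add)
    then have "exp (t * lcs as bs) \<le> exp (t * lcs as1 (take j bs)) * exp (t * lcs as2 (drop j bs))"
      by (simp add: algebra_simps flip: exp_add)
    also have "\<dots> \<le> (\<Sum>j\<le>s. exp (t * lcs as1 (take j bs)) * exp (t * lcs as2 (drop j bs)))"
      using j by (intro member_le_sum) auto
    finally show ?thesis .
  qed
  then have "?E s (\<lambda>bs. exp (t * lcs as bs))
      \<le> ?E s (\<lambda>bs. \<Sum>j\<le>s. exp (t * lcs as1 (take j bs)) * exp (t * lcs as2 (drop j bs)))"
    by (intro expect_list_mono)
  also have "\<dots> = (\<Sum>j\<le>s. ?E j (\<lambda>bs. exp (t * lcs as1 bs)) * ?E (s - j) (\<lambda>bs. exp (t * lcs as2 bs)))"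
    unfolding expect_list_sum by (intro sum.cong refl expect_list_take_drop) simp
  also have "\<dots> \<le> (\<Sum>j\<le>s. (K ^ m * exp (c * (real m * real r / (real d + 1)) + (c * (d / k) + \<epsilon>) * j))
      * exp (c * (r / (real d + 1) + real (s - j) * (d / k))))"
  proof (intro sum_mono mult_mono)
    fix j
    show "?E j (\<lambda>bs. exp (t * lcs as1 bs)) \<le> K ^ m * exp (c * (real m * real r / (real d + 1)) + (c * (d / k) + \<epsilon>) * j)"
      unfolding K_def by (rule Suc.IH) (rule as)
    show "?E (s - j) (\<lambda>bs. exp (t * lcs as2 bs)) \<le> exp (c * (r / (real d + 1) + real (s - j) * (d / k)))"
      using expect_exp_lcs_le[of d as2 k t "s - j"] as assms by (simp add: c_def)
    show "0 \<le> ?E (s - j) (\<lambda>bs. exp (t * lcs as2 bs))"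
      using expect_list_mono[of "s - j" "letter k" "\<lambda>_. 0" "\<lambda>bs. exp (t * lcs as2 bs)"]
        expect_letter_const[of k "s - j" 0] assms by simp
  qed (use K0 in simp)
  also have "\<dots> = (\<Sum>j\<le>s. (K ^ m * exp (c * (real (Suc m) * real r / (real d + 1)) + (c * (d / k) + \<epsilon>) * s))
      * exp (- (\<epsilon> * real (s - j))))"
    by (intro sum.cong refl)
      (simp add: of_nat_diff add_divide_distrib distrib_left distrib_right left_diff_distrib right_diff_distrib
         diff_divide_distrib flip: exp_add)
  also have "\<dots> = (K ^ m * exp (c * (real (Suc m) * real r / (real d + 1)) + (c * (d / k) + \<epsilon>) * s))
      * (\<Sum>j\<le>s. exp (- (\<epsilon> * real (s - j))))"
    by (simp only: sum_distrib_left)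
  also have "\<dots> \<le> (K ^ m * exp (c * (real (Suc m) * real r / (real d + 1)) + (c * (d / k) + \<epsilon>) * s)) * K"
    unfolding K_def using K0[unfolded K_def] assms(5) by (intro mult_left_mono sum_exp_le) auto
  finally show ?case by (simp add: K_def mult_ac)
qed

text \<open>The tangent line bound 1 + (f - b) \<le> exp (f - b) replaces convexity.\<close>

lemma expect_list_jensen_exp:
  assumes "finite (set_pmf p)" "expect_list p n (\<lambda>xs. exp (f xs)) \<le> exp b"
  shows "expect_list p n f \<le> b"
proof -
  have "expect_list p n (\<lambda>xs. 1 + (f xs - b)) \<le> expect_list p n (\<lambda>xs. exp (- b) * exp (f xs))"
    by (intro expect_list_mono) (simp only: exp_add[symmetric], metis add.commute diff_conv_add_uminus exp_ge_add_one_self)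
  also have "\<dots> \<le> exp (- b) * exp b"
    unfolding expect_list_cmult using assms by (intro mult_left_mono) auto
  finally show ?thesis
    by (simp add: expect_list_add expect_list_diff expect_list_const[OF assms(1)] flip: exp_add)
qed

definition mean_lcs :: "nat \<Rightarrow> nat \<Rightarrow> real" where
  "mean_lcs k n = expect_list (letter k) n (\<lambda>as. expect_list (letter k) n (\<lambda>bs. real (lcs as bs)))"

text \<open>The right-hand side does not depend on m, so the bound passes to the limit of long
  words.\<close>

lemma mean_lcs_le:
  fixes t \<epsilon> :: real
  defines "c \<equiv> (exp (2 * t) - 1) / 2"
  assumes "d \<ge> 1" "r + d \<le> k" "t > 0" "\<epsilon> > 0" "r \<ge> 1" "m \<ge> 1"
  shows "mean_lcs k (m * r) / real (m * r)
    \<le> (- ln (1 - exp (- \<epsilon>)) / r + c * (1 / (real d + 1) + d / k) + \<epsilon>) / t"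
proof -
  have k: "k \<ge> 1" using assms by linarith
  define b where "b = m * (- ln (1 - exp (- \<epsilon>))) + (c * (real m * real r / (real d + 1)) + (c * (d / k) + \<epsilon>) * (real m * real r))"
  have "expect_list (letter k) (m * r) (\<lambda>bs. real (lcs as bs)) \<le> b / t" if "length as = m * r" for as
  proof -
    have K: "(1 / (1 - exp (- \<epsilon>))) ^ m = exp (m * (- ln (1 - exp (- \<epsilon>))))"
      using assms by (simp add: exp_of_nat_mult exp_minus inverse_eq_divide power_one_over)
    have expb: "exp b = (1 / (1 - exp (- \<epsilon>))) ^ m *
        exp (c * (real m * real r / (real d + 1)) + (c * (d / k) + \<epsilon>) * real (m * r))"
      unfolding K b_def exp_add[symmetric] of_nat_mult ..
    have "expect_list (letter k) (m * r) (\<lambda>bs. exp (t * real (lcs as bs))) \<le> exp b"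
      unfolding expb c_def using expect_exp_lcs_long_le[OF assms(2,3) less_imp_le[OF assms(4)] assms(5) that, of "m * r"]
      .
    with _ have "expect_list (letter k) (m * r) (\<lambda>bs. t * real (lcs as bs)) \<le> b"
      by (rule expect_list_jensen_exp) (simp add: set_pmf_letter[OF k])
    then show ?thesis
      using assms(4) by (simp add: expect_list_cmult pos_le_divide_eq mult.commute)
  qed
  then have "mean_lcs k (m * r) \<le> expect_list (letter k) (m * r) (\<lambda>as. b / t)"
    unfolding mean_lcs_def by (intro expect_list_mono)
  then have "mean_lcs k (m * r) \<le> b / t" using k by (simp add: expect_letter_const)
  then have "mean_lcs k (m * r) / real (m * r) \<le> b / t / real (m * r)"
    by (rule divide_right_mono) simp
  also have "\<dots> = (- ln (1 - exp (- \<epsilon>)) / r + c * (1 / (real d + 1) + d / k) + \<epsilon>) / t"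
  proof -
    have "b = real (m * r) * (- ln (1 - exp (- \<epsilon>)) / r + c * (1 / (real d + 1) + d / k) + \<epsilon>)"
      unfolding b_def using assms(6) by (simp add: algebra_simps)
    then show ?thesis using assms(6,7) by simp
  qed
  finally show ?thesis .
qed

section \<open>Lower bound\<close>

lemma lcs_upt_le: "z \<le> r \<Longrightarrow> lcs [z..<r] bs \<le> lcs [0..<r] bs"
  using lcs_append_ge[of "[0..<z]" "[]" "[z..<r]" bs] upt_add_eq_append[of 0 z "r - z"] by simp

lemma lcs_drop_le: "lcs as (drop w bs) \<le> lcs as bs"
  using lcs_append_ge[of "[]" "take w bs" as "drop w bs"] by simp

lemma sources_mono: "z \<le> z' \<Longrightarrow> sources z \<eta> \<le> sources z' \<eta>"
  by (induction \<eta> arbitrary: z z') (auto simp: take_Cons split: nat.split)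

lemma sinks_take_mono: "w \<le> w' \<Longrightarrow> sinks r d (take w bs) \<le> sinks r d (take w' bs)"
  by (induction bs arbitrary: w w') (auto simp: take_Cons split: nat.split)

text \<open>If the length S with boundary exceeds T and the exit lies before z0 or w0, then T is at
  most the boundary part plus the plain length. Each bad event is replaced by an exponential that is
  at least 1 on it, so only exponential moments are needed later.\<close>

lemma lcs_ge_exit:
  fixes t T :: real
  assumes "length \<eta> = r" "T \<ge> 0" "t \<ge> 0" "z0 \<le> r" "w0 \<le> length bs"
  shows "T * (1 - exp (t * (T - (sinks r d bs + sources r (fold (step d) bs \<eta>))))
      - (\<Sum>z\<in>{z0..r}. exp (t * (sources z \<eta> + lcs [z..<r] bs - T)))
      - (\<Sum>w\<in>{w0..length bs}. exp (t * (sinks r d (take w bs) + lcs [0..<r] (drop w bs) - T))))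
    - sources z0 \<eta> - sinks r d (take w0 bs) \<le> lcs [0..<r] bs"
proof -
  define S where "S = real (sinks r d bs + sources r (fold (step d) bs \<eta>))"
  define A where "A = (\<Sum>z\<in>{z0..r}. exp (t * (sources z \<eta> + lcs [z..<r] bs - T)))"
  define B where "B = (\<Sum>w\<in>{w0..length bs}. exp (t * (sinks r d (take w bs) + lcs [0..<r] (drop w bs) - T)))"
  have A0: "0 \<le> A" and B0: "0 \<le> B" by (auto simp: A_def B_def intro!: sum_nonneg)
  \<comment> \<open>Some bad event occurs: the factor of T is nonpositive.\<close>
  have trivial: "T * (1 - exp (t * (T - S)) - A - B) - sources z0 \<eta> - sinks r d (take w0 bs) \<le> lcs [0..<r] bs"
    if "1 \<le> exp (t * (T - S)) + A + B"
  proof -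
    have "T * (1 - exp (t * (T - S)) - A - B) \<le> 0"
      using that assms(2) by (intro mult_nonneg_nonpos) auto
    then show ?thesis by linarith
  qed
  have main: "T * (1 - exp (t * (T - S)) - A - B) - sources z0 \<eta> - sinks r d (take w0 bs) \<le> lcs [0..<r] bs"
    if "T \<le> sources z0 \<eta> + sinks r d (take w0 bs) + lcs [0..<r] bs"
  proof -
    have "T * (1 - exp (t * (T - S)) - A - B) \<le> T * 1"
      using assms(2) A0 B0 exp_ge_zero[of "t * (T - S)"] by (intro mult_left_mono) linarith+
    with that show ?thesis by linarith
  qed
  have "T * (1 - exp (t * (T - S)) - A - B) - sources z0 \<eta> - sinks r d (take w0 bs) \<le> lcs [0..<r] bs"
  proof (cases "S \<le> T")
    case True
    then have "1 \<le> exp (t * (T - S))" using assms(3) by simp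
    with A0 B0 show ?thesis by (intro trivial) linarith
  next
    case False
    from assms(1) show ?thesis
    proof (cases rule: sinks_sources_exit[of \<eta> r d bs])
      case (1 z)
      then have S: "S \<le> real (sources z \<eta>) + real (lcs [z..<r] bs)" unfolding S_def by linarith
      show ?thesis
      proof (cases "z0 \<le> z")
        case True
        have "1 \<le> exp (t * (sources z \<eta> + lcs [z..<r] bs - T))"
          using S False assms(3) by simp
        also have "\<dots> \<le> A" unfolding A_def using True 1 by (intro member_le_sum) auto
        finally show ?thesis
          using B0 exp_ge_zero[of "t * (T - S)"] by (intro trivial) linarith
      next
        case z: False
        then have "real (sources z \<eta>) \<le> real (sources z0 \<eta>)"
          using sources_mono[of z z0 \<eta>] by (intro of_nat_mono) simp
        moreover have "real (lcs [z..<r] bs) \<le> real (lcs [0..<r] bs)"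
          using lcs_upt_le[OF 1(1)] by (rule of_nat_mono)
        ultimately show ?thesis using S False by (intro main) linarith
      qed
    next
      case (2 w)
      then have S: "S \<le> real (sinks r d (take w bs)) + real (lcs [0..<r] (drop w bs))"
        unfolding S_def by linarith
      show ?thesis
      proof (cases "w0 \<le> w")
        case True
        have "1 \<le> exp (t * (sinks r d (take w bs) + lcs [0..<r] (drop w bs) - T))"
          using S False assms(3) by simp
        also have "\<dots> \<le> B" unfolding B_def using True 2 by (intro member_le_sum) auto
        finally show ?thesis
          using A0 exp_ge_zero[of "t * (T - S)"] by (intro trivial) linarith
      next
        case w: False
        then have "real (sinks r d (take w bs)) \<le> real (sinks r d (take w0 bs))"
          using sinks_take_mono[of w w0 r d bs] by (intro of_nat_mono) simp
        moreover have "real (lcs [0..<r] (drop w bs)) \<le> real (lcs [0..<r] bs)"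
          using lcs_drop_le by (rule of_nat_mono)
        ultimately show ?thesis using S False by (intro main) linarith
      qed
    qed
  qed
  then show ?thesis by (simp only: S_def A_def B_def of_nat_add)
qed

lemma exp_minus_one_le: "exp t - 1 \<le> (exp (2 * t) - 1) / (2 :: real)"
proof -
  have "0 \<le> (exp t - 1)\<^sup>2" by simp
  also have "\<dots> = exp (2 * t) - 2 * exp t + 1"
    by (simp add: power2_eq_square algebra_simps flip: exp_add)
  finally show ?thesis by simp
qed

text \<open>The sources have density 1 / (d + 1), while the interior estimate may use another
  parameter d'. For d' \<le> d the sum of both bounds decreases in the exit column, so its value at
  z0 covers all later exits.\<close>

lemma expect_exp_sources_exit:
  fixes t T :: real
  assumes "d' \<ge> 1" "d' \<le> d" "r + d \<le> k" "t \<ge> 0" "z0 \<le> z" "z \<le> r"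
  shows "expect_list (site d) r (\<lambda>\<eta>. expect_list (letter k) s (\<lambda>bs. exp (t * (sources z \<eta> + lcs [z..<r] bs - T))))
    \<le> exp (- t * T + (exp (2 * t) - 1) / 2 *
        (z0 / (real d + 1) + real (r - z0) / (real d' + 1) + s * (d' / k)))"
proof -
  let ?c = "(exp (2 * t) - 1) / 2"
  have d: "d \<ge> 1" and k: "k \<ge> 1" using assms by linarith+
  have c: "?c \<ge> 0" using assms by simp
  have eq: "exp (t * (real (sources z \<eta> + lcs [z..<r] bs) - T)) =
      exp (- t * T) * (exp (t * sources z \<eta>) * exp (t * lcs [z..<r] bs))" for \<eta> bs
    by (simp add: algebra_simps flip: exp_add)
  have "expect_list (site d) r (\<lambda>\<eta>. expect_list (letter k) s (\<lambda>bs. exp (t * (sources z \<eta> + lcs [z..<r] bs - T))))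
    = exp (- t * T) * (expect_list (site d) r (\<lambda>\<eta>. exp (t * sources z \<eta>))
      * expect_list (letter k) s (\<lambda>bs. exp (t * lcs [z..<r] bs)))"
    unfolding eq expect_list_cmult expect_list_multc ..
  also have "\<dots> \<le> exp (- t * T) * (exp (?c * (z / (real d + 1))) * exp (?c * (real (r - z) / (real d' + 1) + s * (d' / k))))"
  proof (intro mult_left_mono mult_mono)
    have "expect_list (site d) r (\<lambda>\<eta>. exp (t * sources z \<eta>)) \<le> exp (z * ((exp t - 1) / (real d + 1)))"
      using d assms by (intro expect_exp_sources)
    also have "\<dots> \<le> exp (?c * (z / (real d + 1)))"
    proof -
      have "(exp t - 1) * (z / (real d + 1)) \<le> ?c * (z / (real d + 1))"
        by (intro mult_right_mono exp_minus_one_le) simp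
      then show ?thesis by (simp add: mult.commute)
    qed
    finally show "expect_list (site d) r (\<lambda>\<eta>. exp (t * sources z \<eta>)) \<le> exp (?c * (z / (real d + 1)))" .
    show "expect_list (letter k) s (\<lambda>bs. exp (t * lcs [z..<r] bs)) \<le> exp (?c * (real (r - z) / (real d' + 1) + s * (d' / k)))"
      using expect_exp_lcs_le[of d' "[z..<r]" k t s] assms by simp
    show "0 \<le> expect_list (letter k) s (\<lambda>bs. exp (t * lcs [z..<r] bs))"
      using expect_list_mono[of s "letter k" "\<lambda>_. 0" "\<lambda>bs. exp (t * lcs [z..<r] bs)"]
        expect_letter_const[OF k, of s 0] by simp
  qed simp_all
  also have "\<dots> = exp (- t * T + ?c * (z / (real d + 1) + real (r - z) / (real d' + 1) + s * (d' / k)))"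
    by (simp only: exp_add[symmetric] distrib_left add.assoc)
  also have "\<dots> \<le> exp (- t * T + ?c * (z0 / (real d + 1) + real (r - z0) / (real d' + 1) + s * (d' / k)))"
  proof -
    have "real (z - z0) / (real d + 1) \<le> real (z - z0) / (real d' + 1)"
      using assms by (intro divide_left_mono) auto
    then have "z / (real d + 1) + real (r - z) / (real d' + 1) \<le> z0 / (real d + 1) + real (r - z0) / (real d' + 1)"
      using assms by (simp add: of_nat_diff diff_divide_distrib)
    with c show ?thesis
      unfolding exp_le_cancel_iff by (intro add_left_mono mult_left_mono add_right_mono)
  qed
  finally show ?thesis .
qed

text \<open>Mirror image for exits along the sinks, where the interior parameter d' has to be at
  least d for the bound to decrease in w.\<close>

lemma expect_exp_sinks_exit:
  fixes t T :: real
  assumes "d \<ge> 1" "d \<le> d'" "r + d' \<le> k" "t \<ge> 0" "w0 \<le> w" "w \<le> s"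
  shows "expect_list (letter k) s (\<lambda>bs. exp (t * (sinks r d (take w bs) + lcs [0..<r] (drop w bs) - T)))
    \<le> exp (- t * T + (exp (2 * t) - 1) / 2 *
        (w0 * (d / k) + r / (real d' + 1) + real (s - w0) * (d' / k)))"
proof -
  let ?c = "(exp (2 * t) - 1) / 2"
  have d': "d' \<ge> 1" and k: "k \<ge> 1" using assms by linarith+
  have c: "?c \<ge> 0" using assms by simp
  have eq: "exp (t * (real (sinks r d (take w bs) + lcs [0..<r] (drop w bs)) - T)) =
      exp (- t * T) * (exp (t * sinks r d (take w bs)) * exp (t * lcs [0..<r] (drop w bs)))" for bs
    by (simp add: algebra_simps flip: exp_add)
  have "expect_list (letter k) s (\<lambda>bs. exp (t * (sinks r d (take w bs) + lcs [0..<r] (drop w bs) - T)))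
    = exp (- t * T) * (expect_list (letter k) w (\<lambda>bs. exp (t * sinks r d bs))
      * expect_list (letter k) (s - w) (\<lambda>bs. exp (t * lcs [0..<r] bs)))"
    unfolding eq expect_list_cmult
      expect_list_take_drop[OF assms(6), of _ "\<lambda>bs. exp (t * sinks r d bs)" "\<lambda>bs. exp (t * lcs [0..<r] bs)"] ..
  also have "\<dots> \<le> exp (- t * T) * (exp (?c * (w * (d / k))) * exp (?c * (r / (real d' + 1) + real (s - w) * (d' / k))))"
  proof (intro mult_left_mono mult_mono)
    have "expect_list (letter k) w (\<lambda>bs. exp (t * sinks r d bs)) \<le> exp (w * ((exp t - 1) * (d / k)))"
      using k assms by (intro expect_exp_sinks) auto
    also have "\<dots> \<le> exp (?c * (w * (d / k)))"
    proof -
      have "(exp t - 1) * (w * (d / k)) \<le> ?c * (w * (d / k))"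
        by (intro mult_right_mono exp_minus_one_le) simp
      then show ?thesis by (simp add: mult_ac)
    qed
    finally show "expect_list (letter k) w (\<lambda>bs. exp (t * sinks r d bs)) \<le> exp (?c * (w * (d / k)))" .
    show "expect_list (letter k) (s - w) (\<lambda>bs. exp (t * lcs [0..<r] bs)) \<le> exp (?c * (r / (real d' + 1) + real (s - w) * (d' / k)))"
      using expect_exp_lcs_le[of d' "[0..<r]" k t "s - w"] assms by simp
    show "0 \<le> expect_list (letter k) (s - w) (\<lambda>bs. exp (t * lcs [0..<r] bs))"
      using expect_list_mono[of "s - w" "letter k" "\<lambda>_. 0" "\<lambda>bs. exp (t * lcs [0..<r] bs)"]
        expect_letter_const[OF k, of "s - w" 0] by simp
  qed simp_all
  also have "\<dots> = exp (- t * T + ?c * (w * (d / k) + r / (real d' + 1) + real (s - w) * (d' / k)))"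
    by (simp only: exp_add[symmetric] distrib_left add.assoc)
  also have "\<dots> \<le> exp (- t * T + ?c * (w0 * (d / k) + r / (real d' + 1) + real (s - w0) * (d' / k)))"
  proof -
    have "real (w - w0) * (d / k) \<le> real (w - w0) * (d' / k)"
      using assms by (intro mult_left_mono divide_right_mono) auto
    then have "w * (d / k) + r / (real d' + 1) + real (s - w) * (d' / k)
        \<le> w0 * (d / k) + r / (real d' + 1) + real (s - w0) * (d' / k)"
      using assms by (simp add: of_nat_diff left_diff_distrib diff_divide_distrib)
    with c show ?thesis
      unfolding exp_le_cancel_iff by (intro add_left_mono mult_left_mono)
  qed
  finally show ?thesis .
qed

text \<open>Expectation of \<open>lcs_ge_exit\<close>. The three exponentials bound a stationary
  length below T, a late exit along the sources and a late exit along the sinks; the factors r + 1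
  and s + 1 count exit positions.\<close>

lemma expect_lcs_upt_ge:
  fixes t T :: real
  defines "c \<equiv> (exp (2 * t) - 1) / 2"
  assumes "d1 \<ge> 1" "d1 \<le> d" "d \<le> d2" "r + d2 \<le> k" "t \<ge> 0" "T \<ge> 0" "z0 \<le> r" "w0 \<le> s"
  shows "T * (1 - exp (t * T + (exp (- 2 * t) - 1) / 2 * (r / (real d + 1) + s * (d / k)))
      - real (r + 1) * exp (- t * T + c * (z0 / (real d + 1) + real (r - z0) / (real d1 + 1) + s * (d1 / k)))
      - real (s + 1) * exp (- t * T + c * (w0 * (d / k) + r / (real d2 + 1) + real (s - w0) * (d2 / k))))
    - z0 / (real d + 1) - w0 * (d / k)
    \<le> expect_list (letter k) s (\<lambda>bs. real (lcs [0..<r] bs))"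
proof -
  have d: "d \<ge> 1" and k: "k \<ge> 1" and rd: "r + d \<le> k" using assms by linarith+
  let ?E = "\<lambda>f. expect_list (site d) r (\<lambda>\<eta>. expect_list (letter k) s (f \<eta>))"
  let ?S = "\<lambda>\<eta> bs. real (sinks r d bs) + real (sources r (fold (step d) bs \<eta>))"
  let ?A = "\<lambda>z \<eta> bs. exp (t * (sources z \<eta> + lcs [z..<r] bs - T))"
  let ?B = "\<lambda>w bs. exp (t * (sinks r d (take w bs) + lcs [0..<r] (drop w bs) - T))"
  let ?e1 = "exp (t * T + (exp (- 2 * t) - 1) / 2 * (r / (real d + 1) + s * (d / k)))"
  let ?e2 = "exp (- t * T + c * (z0 / (real d + 1) + real (r - z0) / (real d1 + 1) + s * (d1 / k)))"
  let ?e3 = "exp (- t * T + c * (w0 * (d / k) + r / (real d2 + 1) + real (s - w0) * (d2 / k)))"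
  have Econst: "?E (\<lambda>\<eta> bs. a) = a" for a
    by (simp add: expect_letter_const[OF k] expect_site_const[OF d])
  \<comment> \<open>The lower tail of the stationary length comes from its exponential moment at
    \<open>- t\<close>.\<close>
  have e1: "?E (\<lambda>\<eta> bs. exp (t * (T - ?S \<eta> bs))) \<le> ?e1"
  proof -
    have "exp (t * (T - ?S \<eta> bs)) = exp (t * T) * exp (- t * ?S \<eta> bs)" for \<eta> bs
      by (simp add: algebra_simps flip: exp_add)
    then have "?E (\<lambda>\<eta> bs. exp (t * (T - ?S \<eta> bs))) = exp (t * T) * ?E (\<lambda>\<eta> bs. exp (- t * ?S \<eta> bs))"
      by (simp only: expect_list_cmult)
    also have "\<dots> \<le> exp (t * T) * exp ((exp (2 * (- t)) - 1) / 2 * (r / (real d + 1) + s * (d / k)))"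
      using expect_exp_stationary[OF d rd, of s "- t"] by (intro mult_left_mono) (simp_all add: of_nat_add)
    finally show ?thesis by (simp add: exp_add)
  qed
  have "?E (\<lambda>\<eta> bs. \<Sum>z\<in>{z0..r}. ?A z \<eta> bs) = (\<Sum>z\<in>{z0..r}. ?E (?A z))"
    by (simp only: expect_list_sum)
  also have "\<dots> \<le> (\<Sum>z\<in>{z0..r}. ?e2)"
    unfolding c_def using assms by (intro sum_mono expect_exp_sources_exit) auto
  also have "\<dots> \<le> real (r + 1) * ?e2" unfolding sum_constant by (intro mult_right_mono) auto
  finally have e2: "?E (\<lambda>\<eta> bs. \<Sum>z\<in>{z0..r}. ?A z \<eta> bs) \<le> real (r + 1) * ?e2" .
  have "?E (\<lambda>\<eta> bs. \<Sum>w\<in>{w0..s}. ?B w bs) = (\<Sum>w\<in>{w0..s}. expect_list (letter k) s (?B w))"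
    by (simp only: expect_list_sum expect_site_const[OF d])
  also have "\<dots> \<le> (\<Sum>w\<in>{w0..s}. ?e3)"
    unfolding c_def using assms d by (intro sum_mono expect_exp_sinks_exit) auto
  also have "\<dots> \<le> real (s + 1) * ?e3" unfolding sum_constant by (intro mult_right_mono) auto
  finally have e3: "?E (\<lambda>\<eta> bs. \<Sum>w\<in>{w0..s}. ?B w bs) \<le> real (s + 1) * ?e3" .
  have snk: "expect_list (letter k) s (\<lambda>bs. real (sinks r d (take w0 bs))) = w0 * (d / k)"
    using expect_list_take[of "letter k" w0 s "\<lambda>bs. real (sinks r d bs)"] assms(9) expect_sinks[OF k rd, of w0]
    by (simp add: set_pmf_letter[OF k])
  have "T * (1 - ?e1 - real (r + 1) * ?e2 - real (s + 1) * ?e3) - z0 / (real d + 1) - w0 * (d / k)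
    \<le> T * (1 - ?E (\<lambda>\<eta> bs. exp (t * (T - ?S \<eta> bs))) - ?E (\<lambda>\<eta> bs. \<Sum>z\<in>{z0..r}. ?A z \<eta> bs)
        - ?E (\<lambda>\<eta> bs. \<Sum>w\<in>{w0..s}. ?B w bs)) - z0 / (real d + 1) - w0 * (d / k)"
    using e1 e2 e3 assms(7) by (intro diff_right_mono mult_left_mono) linarith+
  also have "\<dots> = ?E (\<lambda>\<eta> bs. T * (1 - exp (t * (T - ?S \<eta> bs)) - (\<Sum>z\<in>{z0..r}. ?A z \<eta> bs)
      - (\<Sum>w\<in>{w0..s}. ?B w bs)) - sources z0 \<eta> - sinks r d (take w0 bs))"
    using assms(8) by (simp only: expect_list_diff expect_list_cmult Econst snk expect_letter_const[OF k]
        expect_site_const[OF d] expect_sources[OF d])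
  also have "\<dots> \<le> ?E (\<lambda>\<eta> bs. real (lcs [0..<r] bs))"
  proof (intro expect_list_mono)
    fix \<eta> :: "bool list" and bs :: "nat list" assume "length \<eta> = r" "length bs = s"
    then show "T * (1 - exp (t * (T - ?S \<eta> bs)) - (\<Sum>z\<in>{z0..r}. ?A z \<eta> bs)
      - (\<Sum>w\<in>{w0..s}. ?B w bs)) - sources z0 \<eta> - sinks r d (take w0 bs) \<le> real (lcs [0..<r] bs)"
      using lcs_ge_exit[of \<eta> r T t z0 w0 bs d] assms by simp
  qed
  also have "\<dots> = expect_list (letter k) s (\<lambda>bs. real (lcs [0..<r] bs))"
    by (simp only: expect_site_const[OF d])
  finally show ?thesis .
qed

text \<open>Each of the n scanned letters loses at most \<open>card (repeated as) / k\<close>, which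
  has mean at most n^2 / k^2.\<close>

lemma mean_lcs_ge:
  assumes "n \<le> k" "k \<ge> 1"
  shows "expect_list (letter k) n (\<lambda>bs. real (lcs [0..<n] bs)) - real n ^ 3 / real k ^ 2 \<le> mean_lcs k n"
proof -
  let ?e = "expect_list (letter k) n (\<lambda>bs. real (lcs [0..<n] bs))"
  have "expect_list (letter k) n (\<lambda>as. ?e) \<le>
    expect_list (letter k) n (\<lambda>as. expect_list (letter k) n (\<lambda>bs. real (lcs as bs)) + (n / k) * card (repeated as))"
  proof (rule expect_list_mono)
    fix as :: "nat list" assume "length as = n" "set as \<subseteq> set_pmf (letter k)"
    then show "?e \<le> expect_list (letter k) n (\<lambda>bs. real (lcs as bs)) + (n / k) * card (repeated as)"
      using expect_lcs_ge[of as k n] assms by (simp add: set_pmf_letter)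
  qed
  also have "\<dots> = mean_lcs k n + (n / k) * expect_list (letter k) n (\<lambda>as. real (card (repeated as)))"
    by (simp only: mean_lcs_def expect_list_add expect_list_cmult)
  also have "\<dots> \<le> mean_lcs k n + (n / k) * (real n ^ 2 / k)"
    using expect_card_repeated[OF assms(2), of n] by (intro add_left_mono mult_left_mono) auto
  finally show ?thesis using assms(2) by (simp add: expect_letter_const power2_eq_square power3_eq_cube)
qed

section \<open>Superadditivity and existence of the limit\<close>

lemma mean_lcs_superadditive: "k \<ge> 1 \<Longrightarrow> mean_lcs k m + mean_lcs k n \<le> mean_lcs k (m + n)"
proof -
  assume k: "k \<ge> 1"
  let ?E = "\<lambda>n. expect_list (letter k) n"
  have "mean_lcs k m + mean_lcs k n =
    ?E m (\<lambda>as. ?E n (\<lambda>as'. ?E m (\<lambda>bs. ?E n (\<lambda>bs'. real (lcs as bs) + real (lcs as' bs')))))"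
    by (simp only: mean_lcs_def expect_list_add expect_letter_const[OF k])
  also have "\<dots> \<le> ?E m (\<lambda>as. ?E n (\<lambda>as'. ?E m (\<lambda>bs. ?E n (\<lambda>bs'. real (lcs (as @ as') (bs @ bs'))))))"
    by (intro expect_list_mono) (simp only: of_nat_add[symmetric] of_nat_le_iff lcs_append_ge)
  also have "\<dots> = mean_lcs k (m + n)"
    by (simp only: mean_lcs_def expect_list_append)
  finally show ?thesis .
qed

lemma mean_lcs_bounds:
  assumes "k \<ge> 1" shows "0 \<le> mean_lcs k n" "mean_lcs k n \<le> real n"
proof -
  have "expect_list (letter k) n (\<lambda>as. expect_list (letter k) n (\<lambda>bs. 0)) \<le> mean_lcs k n"
    unfolding mean_lcs_def by (intro expect_list_mono) simp
  then show "0 \<le> mean_lcs k n" by (simp add: expect_letter_const[OF assms])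
  have "mean_lcs k n \<le> expect_list (letter k) n (\<lambda>as. expect_list (letter k) n (\<lambda>bs. real n))"
    unfolding mean_lcs_def by (intro expect_list_mono) (metis lcs_le_length of_nat_le_iff)
  then show "mean_lcs k n \<le> real n" by (simp add: expect_letter_const[OF assms])
qed

text \<open>Fekete's lemma. The limit is also the supremum, so a single n bounds it from
  below.\<close>

lemma fekete_superadditive:
  fixes f :: "nat \<Rightarrow> real"
  assumes super: "\<And>m n. f m + f n \<le> f (m + n)" and bounds: "\<And>n. 0 \<le> f n" "\<And>n. f n \<le> real n"
  obtains L where "(\<lambda>n. f n / real n) \<longlonglongrightarrow> L" "\<And>n. f n / real n \<le> L"
proof -
  let ?g = "\<lambda>n. f n / real n"
  have g1: "?g n \<le> 1" for n using bounds(2)[of n] by (cases "n = 0") auto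
  have bdd: "bdd_above (range ?g)" by (rule bdd_aboveI2[where M = 1]) (rule g1)
  define L where "L = (SUP n. ?g n)"
  have le: "?g n \<le> L" for n unfolding L_def using bdd by (rule cSUP_upper2) auto
  have mult: "real q * f N + f j \<le> f (q * N + j)" for q N j
  proof (induction q)
    case (Suc q)
    then show ?case using super[of N "q * N + j"] by (simp add: algebra_simps)
  qed simp
  have "?g \<longlonglongrightarrow> L"
  proof (rule LIMSEQ_I)
    fix e :: real assume e: "e > 0"
    then have "\<exists>N. L - e / 2 < ?g N"
      using less_cSUP_iff[OF _ bdd, of "L - e / 2"] unfolding L_def by auto
    then obtain N where N: "L - e / 2 < ?g N" by blast
    \<comment> \<open>For n > 2 N / e the incomplete last block costs at most N / n < e / 2.\<close>
    have "norm (?g n - L) < e" if n: "n \<ge> max 1 (nat \<lceil>2 * N / e\<rceil> + 1)" for n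
    proof (cases "N = 0")
      case True
      moreover have "0 \<le> ?g n" using bounds(1)[of n] by simp
      ultimately show ?thesis using N le[of n] by simp
    next
      case False
      have n0: "n > 0" and nN: "2 * N / e < n" using n by linarith+
      have "real (n - n mod N) * ?g N \<le> f n"
        using mult[of "n div N" N "n mod N"] bounds(1)[of "n mod N"] False
        by (simp add: minus_mod_eq_div_mult)
      moreover have "(real n - N) * ?g N \<le> real (n - n mod N) * ?g N"
        using False mod_less_divisor[of N n] bounds(1)[of N]
        by (intro mult_right_mono) (auto simp: of_nat_diff)
      moreover have "(real n - N) * ?g N \<ge> real n * ?g N - N"
        using mult_left_mono[OF g1[of N], of "real N"] by (simp only: left_diff_distrib) simp
      ultimately have "real n * ?g N - N \<le> f n" by linarith
      then have "(real n * ?g N - N) / n \<le> ?g n" by (rule divide_right_mono) simp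
      then have "?g N - N / n \<le> ?g n" using n0 by (simp add: diff_divide_distrib)
      moreover have "N / n < e / 2" using nN n0 e by (simp add: field_simps)
      ultimately show ?thesis using N le[of n] by (simp add: abs_if)
    qed
    then show "\<exists>no. \<forall>n\<ge>no. norm (?g n - L) < e" by blast
  qed
  with le show ?thesis using that by blast
qed

section \<open>The limit\<close>

lemma expect_letter_eq_sum:
  assumes "k \<ge> 1"
  shows "expect_list (letter k) n f = (\<Sum>xs\<in>{xs. set xs \<subseteq> {..<k} \<and> length xs = n}. f xs) / real k ^ n"
proof (induction n arbitrary: f)
  case 0
  have "{xs. set xs \<subseteq> {..<k} \<and> length xs = 0} = {[]}" by auto
  then show ?case by simp
next
  case (Suc n)
  let ?L = "{xs. set xs \<subseteq> {..<k} \<and> length xs = n}"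
  have "(\<Sum>xs\<in>{xs. set xs \<subseteq> {..<k} \<and> length xs = Suc n}. f xs) = (\<Sum>(xs, c)\<in>?L \<times> {..<k}. f (c # xs))"
    unfolding lists_length_Suc_eq by (subst sum.reindex) (auto simp: inj_on_def case_prod_unfold)
  also have "\<dots> = (\<Sum>xs\<in>?L. \<Sum>c<k. f (c # xs))" by (rule sum.cartesian_product[symmetric])
  also have "\<dots> = (\<Sum>c<k. \<Sum>xs\<in>?L. f (c # xs))" by (rule sum.swap)
  finally show ?case
    unfolding expect_letter_Suc[OF assms] Suc by (simp add: mult.commute flip: sum_divide_distrib)
qed

lemma expectation_random_words_graph:
  assumes "k \<ge> 1"
  shows "measure_pmf.expectation (random_words_graph n k) (\<lambda>G. real (max_planar_matching G) / real n)
    = mean_lcs k n / real n"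
proof -
  let ?N = "{1..n} <+> {1..n}"
  let ?C = "PiE_dflt ?N 0 (\<lambda>_. {1..k})"
  let ?L = "{xs. set xs \<subseteq> {..<k} \<and> length xs = n}"
  let ?graph = "\<lambda>c. {(a, b) \<in> complete_bipartite n. c (Inl a) = c (Inr b :: nat + nat)} :: (nat \<times> nat) set"
  \<comment> \<open>Characters 1 to k become letters 0 to k - 1, and node \<open>Suc i\<close>
    becomes list position i.\<close>
  define left where "left = (\<lambda>c :: nat + nat \<Rightarrow> nat. map (\<lambda>i. c (Inl (Suc i)) - 1) [0..<n])"
  define right where "right = (\<lambda>c :: nat + nat \<Rightarrow> nat. map (\<lambda>i. c (Inr (Suc i)) - 1) [0..<n])"
  \<comment> \<open>Inverse of the passage to the two words; the value 0 off the nodes is the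
    default that \<open>PiE_dflt\<close> prescribes.\<close>
  define assign where "assign = (\<lambda>(as, bs) v. case v of
      Inl i \<Rightarrow> if i \<in> {1..n} then Suc (as ! (i - 1)) else 0
    | Inr i \<Rightarrow> if i \<in> {1..n} then Suc (bs ! (i - 1)) else (0 :: nat))"
  have fin: "finite ?N" by simp
  have Plus: "Inl i \<in> ?N \<longleftrightarrow> i \<in> {1..n}" "Inr i \<in> ?N \<longleftrightarrow> i \<in> {1..n}" for i :: nat
    by auto
  have C: "c \<in> ?C \<longleftrightarrow> (\<forall>v. if v \<in> ?N then c v \<in> {1..k} else c v = 0)" for c
    by (simp add: PiE_dflt_def)
  have Inl_iff: "(if i \<in> {1..n} then c (Inl i) \<in> {1..k} else c (Inl i) = 0)"
    and Inr_iff: "(if i \<in> {1..n} then c (Inr i) \<in> {1..k} else c (Inr i) = 0)" if "c \<in> ?C" for c i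
    using that[unfolded C, rule_format, of "Inl i"] that[unfolded C, rule_format, of "Inr i"]
    by (simp_all only: Plus)
  have graph: "?graph c = word_edges (left c) (right c)" if c: "c \<in> ?C" for c
  proof -
    have "c (Inl a) = c (Inr b) \<longleftrightarrow> left c ! (a - 1) = right c ! (b - 1)"
      if "a \<in> {1..n}" "b \<in> {1..n}" for a b
    proof -
      have "c (Inl a) \<in> {1..k}" "c (Inr b) \<in> {1..k}"
        using Inl_iff[OF c, of a] Inr_iff[OF c, of b] that by simp_all
      then show ?thesis using that by (auto simp: left_def right_def)
    qed
    then show ?thesis
      unfolding word_edges_def complete_bipartite_def by (auto simp: left_def right_def)
  qed
  have bij: "(\<Sum>c\<in>?C. f (left c) (right c)) = (\<Sum>(as, bs)\<in>?L \<times> ?L. f as bs)"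
    for f :: "nat list \<Rightarrow> nat list \<Rightarrow> real"
  proof (rule sum.reindex_bij_witness[of _ assign "\<lambda>c. (left c, right c)"])
    fix c assume c: "c \<in> ?C"
    have l: "c (Inl i) \<in> {1..k}" "c (Inr i) \<in> {1..k}" if "i \<in> {1..n}" for i
      using Inl_iff[OF c, of i] Inr_iff[OF c, of i] that by simp_all
    have z: "c (Inl i) = 0" "c (Inr i) = 0" if "i \<notin> {1..n}" for i
      using Inl_iff[OF c, of i] Inr_iff[OF c, of i] that by (simp_all split: if_splits)
    show "assign (left c, right c) = c"
    proof
      fix v show "assign (left c, right c) v = c v"
      proof (cases v)
        case (Inl i)
        then show ?thesis using l(1)[of i] z(1)[of i] by (cases "i \<in> {1..n}") (auto simp: assign_def left_def)
      next
        case (Inr i)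
        then show ?thesis using l(2)[of i] z(2)[of i] by (cases "i \<in> {1..n}") (auto simp: assign_def right_def)
      qed
    qed
    have "c (Inl (Suc i)) - 1 < k" "c (Inr (Suc i)) - 1 < k" if "i < n" for i
      using l[of "Suc i"] that by auto
    then show "(left c, right c) \<in> ?L \<times> ?L" by (auto simp: left_def right_def)
  next
    fix p assume p: "p \<in> ?L \<times> ?L"
    then obtain as bs where p': "p = (as, bs)" "length as = n" "length bs = n"
      "set as \<subseteq> {..<k}" "set bs \<subseteq> {..<k}" by auto
    have lt: "as ! i < k" "bs ! i < k" if "i < n" for i
      using p' that subsetD[OF p'(4), of "as ! i"] subsetD[OF p'(5), of "bs ! i"] by simp_all
    have "if v \<in> ?N then assign p v \<in> {1..k} else assign p v = 0" for v
    proof (cases v)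
      case (Inl i)
      show ?thesis unfolding Inl Plus using lt(1)[of "i - 1"] by (auto simp: p'(1) assign_def Suc_le_eq)
    next
      case (Inr i)
      show ?thesis unfolding Inr Plus using lt(2)[of "i - 1"] by (auto simp: p'(1) assign_def Suc_le_eq)
    qed
    then show "assign p \<in> ?C" unfolding C by blast
    show "(left (assign p), right (assign p)) = p"
      unfolding p'(1) using p'(2,3) by (auto simp: left_def right_def assign_def intro!: nth_equalityI)
  qed auto
  have card: "card ?C = k ^ (n + n)"
    by (subst card_PiE_dflt) (auto simp: card_Plus)
  have pos: "?C \<noteq> {}" "finite ?C"
  proof -
    show "finite ?C" using fin by (intro finite_PiE_dflt) auto
    show "?C \<noteq> {}" using card assms by (intro notI) simp
  qed
  have "random_assignment n k = pmf_of_set ?C"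
    unfolding random_assignment_def using assms by (intro Pi_pmf_of_set) auto
  then have "measure_pmf.expectation (random_words_graph n k) (\<lambda>G. real (max_planar_matching G) / real n)
    = measure_pmf.expectation (pmf_of_set ?C) (\<lambda>c. real (max_planar_matching (?graph c)) / real n)"
    unfolding random_words_graph_def by simp
  also have "\<dots> = (\<Sum>c\<in>?C. real (max_planar_matching (?graph c)) / real n) / real (card ?C)"
    by (rule integral_pmf_of_set[OF pos])
  also have "\<dots> = (\<Sum>c\<in>?C. real (lcs (left c) (right c)) / real n) / real k ^ (n + n)"
    unfolding card using graph by (simp add: max_planar_matching_word_edges cong: sum.cong)
  also have "\<dots> = (\<Sum>(as, bs)\<in>?L \<times> ?L. real (lcs as bs) / real n) / real k ^ (n + n)"
    by (simp only: bij[of "\<lambda>as bs. real (lcs as bs) / real n"])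
  also have "\<dots> = (\<Sum>as\<in>?L. \<Sum>bs\<in>?L. real (lcs as bs) / real n) / real k ^ (n + n)"
    by (simp only: sum.cartesian_product)
  also have "\<dots> = mean_lcs k n / real n"
    unfolding mean_lcs_def expect_letter_eq_sum[OF assms]
    by (simp add: power_add mult_ac flip: sum_divide_distrib)
  finally show ?thesis .
qed

section \<open>Asymptotic bounds for the rate\<close>

definition lcs_rate :: "nat \<Rightarrow> real" where
  "lcs_rate k = lim (\<lambda>n. mean_lcs k n / real n)"

lemma
  assumes "k \<ge> 1"
  shows mean_lcs_tendsto: "(\<lambda>n. mean_lcs k n / real n) \<longlonglongrightarrow> lcs_rate k"
    and mean_lcs_le_rate: "mean_lcs k n / real n \<le> lcs_rate k"
proof -
  obtain L where L: "(\<lambda>n. mean_lcs k n / real n) \<longlonglongrightarrow> L" "\<And>n. mean_lcs k n / real n \<le> L"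
    using fekete_superadditive[of "mean_lcs k"] mean_lcs_superadditive[OF assms] mean_lcs_bounds[OF assms]
    by blast
  from L(1) have "lcs_rate k = L" unfolding lcs_rate_def by (rule limI)
  with L show "(\<lambda>n. mean_lcs k n / real n) \<longlonglongrightarrow> lcs_rate k" "mean_lcs k n / real n \<le> lcs_rate k"
    by simp_all
qed

text \<open>Take d about sqrt k, r = k - d and \<epsilon> = t^2 / sqrt k. After scaling by sqrt k
  the surplus \<epsilon> costs t^2, and the price of the cuts, of order ln k / sqrt k, is eventually
  below t^2.\<close>

lemma lcs_rate_upper:
  assumes "t > 0"
  shows "eventually (\<lambda>k. lcs_rate k * sqrt k \<le> (exp (2 * t) - 1 + 2 * t\<^sup>2) / t) sequentially"
proof -
  let ?f = "\<lambda>k::nat. sqrt k * (- ln (1 - exp (- (t\<^sup>2 / sqrt k)))) / (k - sqrt k)"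
  have "(\<lambda>k::nat. sqrt k * (- ln (1 - exp (- (u / sqrt k)))) / (k - sqrt k)) \<longlonglongrightarrow> 0" if "u > 0" for u :: real
    using that by real_asymp
  from this[of "t\<^sup>2"] assms have "eventually (\<lambda>k. ?f k < t\<^sup>2) sequentially"
    by (intro order_tendstoD(2)[where y = 0]) auto
  moreover have "eventually (\<lambda>k::nat. k > 1) sequentially" by (rule eventually_gt_at_top)
  ultimately show ?thesis
  proof eventually_elim
    case (elim k)
    define x where "x = sqrt k"
    have x: "x > 1" "x * x = k" using elim by (simp_all add: x_def)
    define d where "d = nat \<lfloor>x\<rfloor>"
    have d: "real d \<le> x" "x < real d + 1" "d \<ge> 1" using x by (auto simp: d_def le_nat_iff le_floor_iff)
    define r where "r = k - d"
    have "x < x * x" using mult_strict_left_mono[of 1 x x] x by simp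
    then have dk: "real d < k" using d x by linarith
    then have r: "r + d \<le> k" "r \<ge> 1" "real r = k - d" by (auto simp: r_def)
    define \<epsilon> where "\<epsilon> = t\<^sup>2 / x"
    have \<epsilon>: "\<epsilon> > 0" using assms x by (simp add: \<epsilon>_def)
    define c where "c = (exp (2 * t) - 1) / 2"
    have c: "c > 0" using assms by (simp add: c_def)
    define b where "b = (- ln (1 - exp (- \<epsilon>)) / r + c * (1 / (real d + 1) + d / k) + \<epsilon>) / t"
    have le: "mean_lcs k (m * r) / real (m * r) \<le> b" if "m \<ge> 1" for m
      using mean_lcs_le[OF d(3) r(1) assms \<epsilon> r(2) that] by (simp add: b_def c_def)
    \<comment> \<open>The bound holds at multiples of r; this subsequence has the same
      limit.\<close>
    have "(\<lambda>m. mean_lcs k (m * r) / real (m * r)) \<longlonglongrightarrow> lcs_rate k"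
      using LIMSEQ_subseq_LIMSEQ[OF mean_lcs_tendsto[of k], of "\<lambda>m. m * r"] elim r(2)
      by (simp add: strict_mono_def o_def)
    then have "lcs_rate k \<le> b"
      by (rule LIMSEQ_le_const2) (use le in blast)
    then have "lcs_rate k * x \<le> b * x" using x by (intro mult_right_mono) auto
    also have "b * x = (x * (- ln (1 - exp (- \<epsilon>))) / r + c * (x / (real d + 1) + x * d / k) + \<epsilon> * x) / t"
      by (simp add: b_def algebra_simps)
    also have "\<dots> \<le> (t\<^sup>2 + c * (1 + 1) + t\<^sup>2) / t"
    proof (intro divide_right_mono add_mono mult_left_mono)
      have "0 < exp (- \<epsilon>)" "exp (- \<epsilon>) < 1" using \<epsilon> by simp_all
      then have "0 \<le> - ln (1 - exp (- \<epsilon>))" by simp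
      then have "x * (- ln (1 - exp (- \<epsilon>))) / r \<le> x * (- ln (1 - exp (- \<epsilon>))) / (k - x)"
        using x d r \<open>x < x * x\<close> by (intro divide_left_mono mult_nonneg_nonneg mult_pos_pos) auto
      also have "\<dots> \<le> t\<^sup>2" using elim by (simp add: x_def \<epsilon>_def)
      finally show "x * (- ln (1 - exp (- \<epsilon>))) / r \<le> t\<^sup>2" .
      show "x / (real d + 1) \<le> 1" using d by simp
      have "x * d \<le> x * x" using d x by (intro mult_left_mono) auto
      then show "x * d / k \<le> 1" using x elim by (simp add: pos_divide_le_eq)
    qed (use assms c x in \<open>auto simp: \<epsilon>_def\<close>)
    also have "t\<^sup>2 + c * (1 + 1) + t\<^sup>2 = exp (2 * t) - 1 + 2 * t\<^sup>2" by (simp add: c_def)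
    finally show ?case unfolding x_def .
  qed
qed

text \<open>The ratio n / sqrt k is about k powr (1 / 8), so a negative exponent of that order beats
  the polynomial factor n + 1.\<close>

lemma scaled_exp_tendsto_zero:
  fixes n :: "nat \<Rightarrow> nat" and E :: "nat \<Rightarrow> real"
  assumes n_def: "n = (\<lambda>k. nat \<lfloor>k powr (5 / 8)\<rfloor>)"
    and "(\<lambda>k. E k / (n k / sqrt k)) \<longlonglongrightarrow> l" "l < 0"
  shows "(\<lambda>k. real (n k + 1) * exp (E k)) \<longlonglongrightarrow> 0"
proof -
  have "(\<lambda>k::nat. (real (nat \<lfloor>k powr (5 / 8)\<rfloor>) + 1) * exp (- a * (nat \<lfloor>k powr (5 / 8)\<rfloor> / sqrt k))) \<longlonglongrightarrow> 0"
    if "a > 0" for a :: real using that by real_asymp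
  from this[of "- l / 2"] assms(3)
  have lim: "(\<lambda>k. real (n k + 1) * exp (l / 2 * (n k / sqrt k))) \<longlonglongrightarrow> 0"
    by (simp add: n_def add.commute)
  have "eventually (\<lambda>k::nat. real (nat \<lfloor>k powr (5 / 8)\<rfloor>) / sqrt k > 0) sequentially" by real_asymp
  moreover have "eventually (\<lambda>k. E k / (n k / sqrt k) < l / 2) sequentially"
    using assms(2,3) by (intro order_tendstoD(2)) auto
  ultimately have "eventually (\<lambda>k. norm (real (n k + 1) * exp (E k))
      \<le> real (n k + 1) * exp (l / 2 * (n k / sqrt k))) sequentially"
  proof eventually_elim
    case (elim k)
    then have "E k < l / 2 * (n k / sqrt k)" unfolding n_def by (simp only: pos_divide_less_eq)
    then show ?case by (simp add: mult_left_mono)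
  qed
  then show ?thesis using lim by (rule Lim_null_comparison)
qed

lemma lcs_rate_lower:
  fixes \<delta> :: real
  assumes "0 < \<delta>" "\<delta> < 1"
  shows "eventually (\<lambda>k. 2 - 3 * \<delta> \<le> lcs_rate k * sqrt k) sequentially"
proof -
  define g where "g = \<delta> ^ 3 / (1 + \<delta>)"
  have g: "g > 0" "g < \<delta>"
  proof -
    show "g > 0" using assms by (simp add: g_def)
    have "\<delta> ^ 3 \<le> \<delta>" using assms power_decreasing[of 1 3 \<delta>] by simp
    moreover have "\<delta> * 1 < \<delta> * (1 + \<delta>)" using assms by (intro mult_strict_left_mono) auto
    ultimately have "\<delta> ^ 3 < \<delta> * (1 + \<delta>)" by linarith
    then show "g < \<delta>" using assms by (simp add: g_def pos_divide_less_eq)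
  qed
  \<comment> \<open>Exponent of a late exit in units of n / sqrt k. Changing the density by the
    factor 1 + \<delta> costs \<delta>^2 / (1 + \<delta>) over the optimum 2, while the boundary
    stretch of length \<delta> grows at rate 1 instead of 1 + \<delta> and saves \<delta>^2; the net
    loss is g.\<close>
  have gap: "\<delta> + (1 - \<delta>) * (1 + \<delta>) + 1 / (1 + \<delta>) = 2 - g"
    using assms by (simp add: g_def field_simps power3_eq_cube)
  \<comment> \<open>The level 2 - g / 2 lies strictly between the late exit value 2 - g and the
    stationary value 2, so for small t the first-order terms decide both signs.\<close>
  obtain t where t: "t > 0" "t * (2 - g / 2) + (exp (- 2 * t) - 1) < 0"
    "- t * (2 - g / 2) + (exp (2 * t) - 1) / 2 * (2 - g) < 0"
  proof -
    have "eventually (\<lambda>t::real. t * (2 - g / 2) + (exp (- 2 * t) - 1) < 0) (at_right 0)"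
      using g(1) by real_asymp
    moreover have "eventually (\<lambda>t::real. - t * (2 - g / 2) + (exp (2 * t) - 1) / 2 * (2 - g) < 0) (at_right 0)"
      using g(1) by real_asymp
    moreover have "eventually (\<lambda>t::real. t > 0) (at_right 0)" by (rule eventually_at_right_less)
    ultimately have "eventually (\<lambda>t. t > 0 \<and> t * (2 - g / 2) + (exp (- 2 * t) - 1) < 0 \<and>
        - t * (2 - g / 2) + (exp (2 * t) - 1) / 2 * (2 - g) < 0) (at_right 0)"
      by eventually_elim simp
    then show ?thesis using that eventually_happens'[of "at_right (0::real)"] by auto
  qed
  define c where "c = (exp (2 * t) - 1) / 2"
  \<comment> \<open>Any exponent between 1/2 and 3/4 separates the two demands: n / sqrt k must
    outgrow ln k, and the repetition cost n^2 sqrt k / k^2 must vanish.\<close>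
  define n where "n = (\<lambda>k::nat. nat \<lfloor>k powr (5 / 8)\<rfloor>)"
  define d where "d = (\<lambda>k::nat. nat \<lfloor>sqrt k\<rfloor>)"
  \<comment> \<open>Perturbed parameters for exits along the sources (d1) and along the sinks (d2),
    rounded so that d1 \<le> d \<le> d2. The threshold z0 serves for columns and rows alike.\<close>
  define d1 where "d1 = (\<lambda>k::nat. nat \<lfloor>sqrt k / (1 + \<delta>)\<rfloor>)"
  define d2 where "d2 = (\<lambda>k::nat. nat \<lceil>sqrt k * (1 + \<delta>)\<rceil>)"
  define z0 where "z0 = (\<lambda>k::nat. nat \<lceil>\<delta> * n k\<rceil>)"
  define T where "T = (\<lambda>k. (2 - g / 2) * (n k / sqrt k))"
  define E1 where "E1 = (\<lambda>k. t * T k + (exp (- 2 * t) - 1) / 2 * (n k / (real (d k) + 1) + n k * (d k / k)))"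
  define E2 where "E2 = (\<lambda>k. - t * T k + c * (z0 k / (real (d k) + 1) + real (n k - z0 k) / (real (d1 k) + 1) + n k * (d1 k / k)))"
  define E3 where "E3 = (\<lambda>k. - t * T k + c * (z0 k * (d k / k) + n k / (real (d2 k) + 1) + real (n k - z0 k) * (d2 k / k)))"
  have asymp: "(\<lambda>k. sqrt k / (real (d k) + 1)) \<longlonglongrightarrow> 1" "(\<lambda>k. sqrt k * (d k / k)) \<longlonglongrightarrow> 1"
    unfolding d_def by real_asymp+
  have asymp1: "(\<lambda>k. sqrt k / (real (d1 k) + 1)) \<longlonglongrightarrow> 1 + \<delta>" "(\<lambda>k. sqrt k * (d1 k / k)) \<longlonglongrightarrow> 1 / (1 + \<delta>)"
    unfolding d1_def using assms by (real_asymp simp: field_simps)+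
  have asymp2: "(\<lambda>k. sqrt k / (real (d2 k) + 1)) \<longlonglongrightarrow> 1 / (1 + \<delta>)" "(\<lambda>k. sqrt k * (d2 k / k)) \<longlonglongrightarrow> 1 + \<delta>"
    unfolding d2_def using assms by (real_asymp simp: field_simps)+
  have asympz: "(\<lambda>k. z0 k / n k) \<longlonglongrightarrow> \<delta>"
    unfolding z0_def n_def using assms by real_asymp
  have n_pos: "eventually (\<lambda>k. n k > 0 \<and> k > 0) sequentially"
  proof -
    have "eventually (\<lambda>k::nat. real (nat \<lfloor>k powr (5 / 8)\<rfloor>) > 0) sequentially" by real_asymp
    with eventually_gt_at_top[of 0] show ?thesis by eventually_elim (simp add: n_def)
  qed
  have z0_le: "eventually (\<lambda>k. z0 k \<le> n k) sequentially"
    using n_pos order_tendstoD(2)[OF asympz assms(2)] by eventually_elim simp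
  have asympz': "(\<lambda>k. real (n k - z0 k) / n k) \<longlonglongrightarrow> 1 - \<delta>"
  proof (rule Lim_transform_eventually)
    show "(\<lambda>k. 1 - z0 k / n k) \<longlonglongrightarrow> 1 - \<delta>" by (intro tendsto_intros asympz)
    show "eventually (\<lambda>k. 1 - z0 k / n k = real (n k - z0 k) / n k) sequentially"
      using n_pos z0_le by eventually_elim (simp add: of_nat_diff diff_divide_distrib)
  qed
  have "(\<lambda>k. E1 k / (n k / sqrt k)) \<longlonglongrightarrow> t * (2 - g / 2) + (exp (- 2 * t) - 1)"
  proof (rule Lim_transform_eventually)
    show "(\<lambda>k. t * (2 - g / 2) + (exp (- 2 * t) - 1) / 2 * (sqrt k / (real (d k) + 1) + sqrt k * (d k / k)))
        \<longlonglongrightarrow> t * (2 - g / 2) + (exp (- 2 * t) - 1)"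
      by (rule tendsto_eq_intros asymp refl)+ simp
    show "eventually (\<lambda>k. t * (2 - g / 2) + (exp (- 2 * t) - 1) / 2 * (sqrt k / (real (d k) + 1) + sqrt k * (d k / k))
        = E1 k / (n k / sqrt k)) sequentially"
      using n_pos by eventually_elim (simp add: E1_def T_def divide_simps, simp add: algebra_simps)
  qed
  from scaled_exp_tendsto_zero[OF n_def this t(2)]
  have "(\<lambda>k. real (n k + 1) * exp (E1 k)) \<longlonglongrightarrow> 0" .
  then have e1: "(\<lambda>k. exp (E1 k)) \<longlonglongrightarrow> 0"
    by (rule tendsto_0_le[where K = 1]) simp
  have "(\<lambda>k. E2 k / (n k / sqrt k)) \<longlonglongrightarrow> - t * (2 - g / 2) + c * (2 - g)"
  proof (rule Lim_transform_eventually)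
    show "(\<lambda>k. - t * (2 - g / 2) + c * (z0 k / n k * (sqrt k / (real (d k) + 1))
          + real (n k - z0 k) / n k * (sqrt k / (real (d1 k) + 1)) + sqrt k * (d1 k / k)))
        \<longlonglongrightarrow> - t * (2 - g / 2) + c * (2 - g)"
      unfolding gap[symmetric] by (rule tendsto_eq_intros asymp asymp1 asympz asympz' refl)+ simp
    show "eventually (\<lambda>k. - t * (2 - g / 2) + c * (z0 k / n k * (sqrt k / (real (d k) + 1))
          + real (n k - z0 k) / n k * (sqrt k / (real (d1 k) + 1)) + sqrt k * (d1 k / k))
        = E2 k / (n k / sqrt k)) sequentially"
      using n_pos by eventually_elim (simp add: E2_def T_def divide_simps, simp add: algebra_simps)
  qed
  from scaled_exp_tendsto_zero[OF n_def this] t(3)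
  have e2: "(\<lambda>k. real (n k + 1) * exp (E2 k)) \<longlonglongrightarrow> 0" by (simp add: c_def)
  have "(\<lambda>k. E3 k / (n k / sqrt k)) \<longlonglongrightarrow> - t * (2 - g / 2) + c * (2 - g)"
  proof (rule Lim_transform_eventually)
    show "(\<lambda>k. - t * (2 - g / 2) + c * (z0 k / n k * (sqrt k * (d k / k))
          + real (n k - z0 k) / n k * (sqrt k * (d2 k / k)) + sqrt k / (real (d2 k) + 1)))
        \<longlonglongrightarrow> - t * (2 - g / 2) + c * (2 - g)"
      unfolding gap[symmetric] by (rule tendsto_eq_intros asymp asymp2 asympz asympz' refl)+ simp
    show "eventually (\<lambda>k. - t * (2 - g / 2) + c * (z0 k / n k * (sqrt k * (d k / k))
          + real (n k - z0 k) / n k * (sqrt k * (d2 k / k)) + sqrt k / (real (d2 k) + 1))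
        = E3 k / (n k / sqrt k)) sequentially"
      using n_pos by eventually_elim (simp add: E3_def T_def divide_simps, simp add: algebra_simps)
  qed
  from scaled_exp_tendsto_zero[OF n_def this] t(3)
  have e3: "(\<lambda>k. real (n k + 1) * exp (E3 k)) \<longlonglongrightarrow> 0" by (simp add: c_def)
  define lb where "lb = (\<lambda>k. (2 - g / 2) * (1 - exp (E1 k) - real (n k + 1) * exp (E2 k) - real (n k + 1) * exp (E3 k))
      - z0 k / n k * (sqrt k / (real (d k) + 1)) - z0 k / n k * (sqrt k * (d k / k)) - real (n k) ^ 2 * sqrt k / real k ^ 2)"
  have "(\<lambda>k. real (n k) ^ 2 * sqrt k / real k ^ 2) \<longlonglongrightarrow> 0" unfolding n_def by real_asymp
  \<comment> \<open>The two terms \<delta> are the sources and sinks collected before the threshold;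
    the limit exceeds 2 - 3 \<delta> because g < \<delta>.\<close>
  then have "lb \<longlonglongrightarrow> (2 - g / 2) * (1 - 0 - 0 - 0) - \<delta> * 1 - \<delta> * 1 - 0"
    unfolding lb_def by (intro tendsto_intros e1 e2 e3 asymp asympz)
  then have "eventually (\<lambda>k. 2 - 3 * \<delta> < lb k) sequentially"
    by (rule order_tendstoD) (use g in simp)
  moreover have "eventually (\<lambda>k. real (n k) + real (d2 k) \<le> real k) sequentially"
    unfolding n_def d2_def using assms by real_asymp
  moreover have "eventually (\<lambda>k. real (d1 k) \<ge> 1) sequentially"
    unfolding d1_def using assms by real_asymp
  ultimately show ?thesis using n_pos z0_le
  proof eventually_elim
    case (elim k)
    define x where "x = sqrt k"
    have x: "x > 0" "x * x = k" using elim by (simp_all add: x_def)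
    have k: "k \<ge> 1" "n k \<le> k" "n k + d2 k \<le> k" using elim by linarith+
    have "d1 k \<le> d k" unfolding d1_def d_def x_def[symmetric]
      using assms x by (intro nat_mono floor_mono) (simp add: divide_le_eq)
    moreover have "d k \<le> d2 k"
    proof -
      have "x \<le> x * (1 + \<delta>)" using assms x by simp
      then have "\<lfloor>x\<rfloor> \<le> \<lceil>x * (1 + \<delta>)\<rceil>" by linarith
      then show ?thesis unfolding d_def d2_def x_def[symmetric] by (rule nat_mono)
    qed
    moreover have "T k \<ge> 0" using g assms by (simp add: T_def)
    ultimately have "T k * (1 - exp (E1 k) - real (n k + 1) * exp (E2 k) - real (n k + 1) * exp (E3 k))
        - z0 k / (real (d k) + 1) - z0 k * (d k / k) \<le> expect_list (letter k) (n k) (\<lambda>bs. real (lcs [0..<n k] bs))"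
      using expect_lcs_upt_ge[of "d1 k" "d k" "d2 k" "n k" k t "T k" "z0 k" "z0 k" "n k"] elim k t(1)
      unfolding E1_def E2_def E3_def c_def by simp
    with mean_lcs_ge[OF k(2,1)]
    have "(T k * (1 - exp (E1 k) - real (n k + 1) * exp (E2 k) - real (n k + 1) * exp (E3 k))
        - z0 k / (real (d k) + 1) - z0 k * (d k / k) - real (n k) ^ 3 / real k ^ 2) \<le> mean_lcs k (n k)"
      by linarith
    then have "(T k * (1 - exp (E1 k) - real (n k + 1) * exp (E2 k) - real (n k + 1) * exp (E3 k))
        - z0 k / (real (d k) + 1) - z0 k * (d k / k) - real (n k) ^ 3 / real k ^ 2) * (x / n k)
        \<le> mean_lcs k (n k) * (x / n k)"
      using x by (intro mult_right_mono) auto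
    also have "(T k * (1 - exp (E1 k) - real (n k + 1) * exp (E2 k) - real (n k + 1) * exp (E3 k))
        - z0 k / (real (d k) + 1) - z0 k * (d k / k) - real (n k) ^ 3 / real k ^ 2) * (x / n k) = lb k"
    proof -
      have T: "T k * (x / n k) = 2 - g / 2" using elim x by (simp add: T_def x_def)
      have "(T k * a - b1 - b2 - b3) * y = (T k * y) * a - b1 * y - b2 * y - b3 * y" for a b1 b2 b3 y
        by (simp add: algebra_simps)
      from this[where y = "x / n k"] have scale: "(T k * a - b1 - b2 - b3) * (x / n k) = (2 - g / 2) * a - b1 * (x / n k) - b2 * (x / n k) - b3 * (x / n k)"
        for a b1 b2 b3 unfolding T by simp
      have "real (n k) ^ 3 / real k ^ 2 * (x / n k) = real (n k) ^ 2 * x / real k ^ 2"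
        using elim by (simp add: power2_eq_square power3_eq_cube)
      then show ?thesis unfolding scale lb_def x_def[symmetric] by (simp add: mult_ac)
    qed
    also have "mean_lcs k (n k) * (x / n k) = mean_lcs k (n k) / n k * x" by simp
    also have "\<dots> \<le> lcs_rate k * x"
      using x by (intro mult_right_mono mean_lcs_le_rate k) auto
    finally show ?case using elim by (simp add: x_def)
  qed
qed

theorem corollary2:
  shows "\<exists>\<gamma> :: nat \<Rightarrow> real.
    (\<forall>k\<ge>1. (\<lambda>n. measure_pmf.expectation (random_words_graph n k)
                   (\<lambda>G. real (max_planar_matching G) / real n)) \<longlonglongrightarrow> \<gamma> k) \<and>
    (\<lambda>k. \<gamma> k * sqrt (real k)) \<longlonglongrightarrow> 2"
proof (intro exI[of _ lcs_rate] conjI allI impI)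
  fix k :: nat assume k: "1 \<le> k"
  show "(\<lambda>n. measure_pmf.expectation (random_words_graph n k)
      (\<lambda>G. real (max_planar_matching G) / real n)) \<longlonglongrightarrow> lcs_rate k"
    unfolding expectation_random_words_graph[OF k] by (rule mean_lcs_tendsto[OF k])
next
  show "(\<lambda>k. lcs_rate k * sqrt (real k)) \<longlonglongrightarrow> 2"
  proof (rule order_tendstoI)
    fix a :: real assume a: "a < 2"
    \<comment> \<open>The quarter gives 3 \<delta> \<le> 3 (2 - a) / 4 < 2 - a; the half keeps
      \<delta> below 1.\<close>
    define \<delta> where "\<delta> = min (1 / 2) ((2 - a) / 4)"
    have \<delta>: "0 < \<delta>" "\<delta> < 1" "a < 2 - 3 * \<delta>" using a by (auto simp: \<delta>_def min_def field_simps)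
    from lcs_rate_lower[OF \<delta>(1,2)] show "eventually (\<lambda>k. a < lcs_rate k * sqrt k) sequentially"
      by eventually_elim (use \<delta>(3) in linarith)
  next
    fix a :: real assume a: "2 < a"
    \<comment> \<open>The limit is the derivative of exp (2 t) at 0; t is fixed first, and only then
      does k grow.\<close>
    have "((\<lambda>t::real. (exp (2 * t) - 1 + 2 * t\<^sup>2) / t) \<longlongrightarrow> 2) (at_right 0)" by real_asymp
    then have "eventually (\<lambda>t::real. (exp (2 * t) - 1 + 2 * t\<^sup>2) / t < a) (at_right 0)"
      using a by (rule order_tendstoD(2))
    with eventually_at_right_less[of 0]
    have "eventually (\<lambda>t::real. t > 0 \<and> (exp (2 * t) - 1 + 2 * t\<^sup>2) / t < a) (at_right 0)"
      by eventually_elim simp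
    then obtain t :: real where t: "t > 0" "(exp (2 * t) - 1 + 2 * t\<^sup>2) / t < a"
      using eventually_happens'[of "at_right (0::real)"] by auto
    from lcs_rate_upper[OF t(1)] show "eventually (\<lambda>k. lcs_rate k * sqrt k < a) sequentially"
      by eventually_elim (use t(2) in linarith)
  qed
qed

end
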